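(* Let $\alpha,\beta>0$, $1\le p,q\le\infty$ and $f:\mathbb{Z}\to\mathbb{R}$ be such that $f\in\Lambda_H^{\alpha,p,q}$. Then $(I-\Delta_d)^{-\beta/2}f\in\Lambda_H^{\alpha+\beta,p,q}$.
   Context: $[x]$ denotes the integer part of $x$; $\|\cdot\|_p$ is the norm of $\ell^p(\mathbb{Z})$. Weighted space: $\mu=\sum_{n\in\mathbb{Z}}\frac{1}{1+|n|}\delta_n$ ($\delta_n$ the Dirac measure at $n$). So $g\in\ell^q(\mathbb{Z},\mu)$ means $\sum_{n}|g(n)|^q\frac{1}{1+|n|}<\infty$ if $1\le q<\infty$, and $\ell^\infty(\mathbb{Z},\mu)=\ell^\infty(\mathbb{Z})$. The expression $\frac{f}{1+|\cdot|^\alpha}$ is the sequence $n\mapsto \frac{f(n)}{1+|n|^\alpha}$. Discrete Laplacian: $\Delta_df(n)=f(n+1)-2f(n)+f(n-1)$. Heat semigroup: $e^{t\Delta_d}f(n)=\sum_{j\in\mathbb{Z}}G(t,n-j)f(j)$, with $G(t,n)=e^{-2t}I_n(2t)$, $t>0$, $n\in\mathbb{Z}$, and $I_n$ the modified Bessel function of the first kind of order $n$. Mixed norms: for a function $F$ of $t>0$ with values in sequences on $\mathbb{Z}$, $\|F\|_{p,q}=\left(\int_0^\infty\|F(t)\|_p^q\frac{dt}{t}\right)^{1/q}$ for $1\le q<\infty$ and $\|F\|_{p,\infty}=\operatorname{ess\,sup}_{t>0}\|F(t)\|_p$. For $\alpha>0$, $\Lambda_H^{\alpha,p,q}$ is the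 set of $f:\mathbb{Z}\to\mathbb{R}$ with $\frac{f}{1+|\cdot|^\alpha}\in\ell^q(\mathbb{Z},\mu)$ and $\|t^{k-\alpha/2}\partial_t^ke^{t\Delta_d}f\|_{p,q}<\infty$, where $k=[\alpha/2]+1$. Bessel potential of order $\beta>0$ ($I$ is the identity operator): $(I-\Delta_d)^{-\beta/2}f(n)=\frac{1}{\Gamma(\beta/2)}\int_0^\infty e^{-\tau}e^{\tau\Delta_d}f(n)\,\tau^{\beta/2}\frac{d\tau}{\tau}$, $n\in\mathbb{Z}$. *)

theory Defs
  imports "HOL-Analysis.Analysis" "HOL-Probability.Essential_Supremum"
begin

text \<open>
  Modified Bessel function of the first kind of integer order, by its power series at \<open>x > 0\<close>.
  \<^const>\<open>rGamma\<close> is the entire reciprocal Gamma function, so for negative \<open>\<nu>\<close> the terms with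
  \<open>m + \<nu> < 0\<close> vanish, as usual.
\<close>

definition bessel_I :: "int \<Rightarrow> real \<Rightarrow> real" where
  "bessel_I \<nu> x =
     (\<Sum>m. (x / 2) powi (2 * int m + \<nu>) * rGamma (of_int (int m + \<nu> + 1)) / fact m)"

definition heat_kernel :: "real \<Rightarrow> int \<Rightarrow> real" where
  "heat_kernel t n = exp (- 2 * t) * bessel_I n (2 * t)"

text \<open>
  The heat semigroup is only meaningful for \<open>t > 0\<close> and when the sum converges absolutely;
  otherwise \<^const>\<open>infsum\<close> returns the default value \<open>0\<close>. The weighted growth condition in
  \<open>Lambda_H\<close> below guarantees absolute convergence.
\<close>

definition heat_semigroup :: "real \<Rightarrow> (int \<Rightarrow> real) \<Rightarrow> int \<Rightarrow> real" where
  "heat_semigroup t f n = (\<Sum>\<^sub>\<infinity>j\<in>UNIV. heat_kernel t (n - j) * f j)"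

definition bessel_potential :: "real \<Rightarrow> (int \<Rightarrow> real) \<Rightarrow> int \<Rightarrow> real" where
  "bessel_potential \<beta> f n =
     1 / Gamma (\<beta> / 2) *
     (LINT \<tau>:{0<..}|lborel. exp (- \<tau>) * heat_semigroup \<tau> f n * \<tau> powr (\<beta> / 2) / \<tau>)"

text \<open>Powers of extended nonnegative numbers, used with exponents \<open>r > 0\<close> only.\<close>

definition ennpowr :: "ennreal \<Rightarrow> real \<Rightarrow> ennreal" where
  "ennpowr x r = (if x = \<infinity> then \<infinity> else ennreal (enn2real x powr r))"

text \<open>
  Norms take values in \<open>[0, \<infinity>]\<close>, and exponents are extended reals \<open>p\<close> with \<open>1 \<le> p \<le> \<infinity>\<close>.
\<close>

definition lp_norm :: "ennreal \<Rightarrow> (int \<Rightarrow> real) \<Rightarrow> ennreal" where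
  "lp_norm p g =
     (if p = \<infinity> then (SUP n. ennreal \<bar>g n\<bar>)
      else ennpowr (\<integral>\<^sup>+ n. ennreal (\<bar>g n\<bar> powr enn2real p) \<partial>count_space UNIV) (1 / enn2real p))"

definition mixed_norm :: "ennreal \<Rightarrow> ennreal \<Rightarrow> (real \<Rightarrow> int \<Rightarrow> real) \<Rightarrow> ennreal" where
  "mixed_norm p q F =
     (if q = \<infinity> then esssup (restrict_space lborel {0<..}) (\<lambda>t. lp_norm p (F t))
      else ennpowr
        (\<integral>\<^sup>+ t\<in>{0<..}. (ennpowr (lp_norm p (F t)) (enn2real q) * ennreal (1 / t)) \<partial>lborel)
        (1 / enn2real q))"

text \<open>The space \<open>\<ell>\<^sup>q(\<int>, \<mu>)\<close> for the measure \<open>\<mu>\<close> with mass \<open>1 / (1 + \<bar>n\<bar>)\<close> at \<open>n\<close>.\<close>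

definition weighted_lq :: "ennreal \<Rightarrow> (int \<Rightarrow> real) set" where
  "weighted_lq q =
     (if q = \<infinity> then {g. bounded (range g)}
      else {g. (\<lambda>n. \<bar>g n\<bar> powr enn2real q * (1 / (1 + \<bar>real_of_int n\<bar>))) summable_on UNIV})"

definition Lambda_H :: "real \<Rightarrow> ennreal \<Rightarrow> ennreal \<Rightarrow> (int \<Rightarrow> real) set" where
  "Lambda_H \<alpha> p q =
     {f. (\<lambda>n. f n / (1 + \<bar>real_of_int n\<bar> powr \<alpha>)) \<in> weighted_lq q \<and>
         (let k = nat \<lfloor>\<alpha> / 2\<rfloor> + 1 in
          mixed_norm p q
            (\<lambda>t n. t powr (real k - \<alpha> / 2) *
                   (deriv ^^ k) (\<lambda>s. heat_semigroup s f n) t) < \<infinity>)}"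

end

theory Submission
  imports Defs
begin

text \<open>
  Let \<open>u(t) = e\<^bsup>t\<Delta>\<^esup> f\<close>, let \<open>g\<close> be the Bessel potential of \<open>f\<close>, and let \<open>k\<close>, \<open>l\<close> be the numbers of time
  derivatives in the definitions of the two spaces, so that \<open>k \<le> l\<close> and \<open>l > (\<alpha> + \<beta>) / 2\<close>.

  The \<open>k\<close>-th time derivative of \<open>u\<close> is \<open>e\<^bsup>t\<Delta>\<^esup> \<Delta>\<^sup>k f\<close> (\<open>higher_deriv_heat\<close>). The Bessel potential is an
  average of \<open>u(\<tau>)\<close> against the Gamma density of shape \<open>\<beta> / 2\<close>, so the semigroup law turns \<open>\<partial>\<^sub>t\<^sup>l e\<^bsup>t\<Delta>\<^esup> g\<close> into
  the average of \<open>e\<^bsup>(t + \<tau>)\<Delta>\<^esup> \<Delta>\<^sup>l f\<close> against the same density (\<open>heat_bessel\<close>). With \<open>s = t + \<tau>\<close>, half of the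
  time \<open>s\<close> is spent on the smoothing estimate \<open>\<parallel>e\<^bsup>s\<Delta>\<^esup> \<Delta>\<^sup>m h\<parallel>\<^sub>p \<le> C s\<^bsup>-m\<^esup> \<parallel>h\<parallel>\<^sub>p\<close> for \<open>m = l - k\<close>
  (\<open>lp_norm_heat_lap_power_le\<close>); the other half leaves \<open>v(s / 2)\<close>, where \<open>v(s) = s\<^bsup>k - \<alpha>/2\<^esup> \<parallel>\<partial>\<^sub>s\<^sup>k u(s)\<parallel>\<^sub>p\<close>.
  After Minkowski's inequality and the substitution \<open>\<tau> = t r\<close> all powers of \<open>t\<close> cancel, and
  \<open>t\<^bsup>l - (\<alpha> + \<beta>)/2\<^esup> \<parallel>\<partial>\<^sub>t\<^sup>l e\<^bsup>t\<Delta>\<^esup> g\<parallel>\<^sub>p\<close> is at most a constant times the integral over \<open>r > 0\<close> of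
  \<open>r\<^bsup>\<beta>/2 - 1\<^esup> (1 + r)\<^bsup>\<alpha>/2 - l\<^esup> v(t (1 + r) / 2)\<close> (\<open>heat_bessel_average\<close>). The weight in \<open>r\<close> is integrable because
  \<open>\<beta> > 0\<close> and \<open>l > (\<alpha> + \<beta>) / 2\<close>, and dilations preserve \<open>dt / t\<close>, so this is an average of functions with
  the same \<open>L\<^sup>q(dt / t)\<close> norm as \<open>v\<close> (\<open>mixed_norm_average_finite\<close>).

  The smoothing estimate rests on one structural fact: the heat kernel at time \<open>t\<close> is the distribution of
  the difference of two independent Poisson variables of mean \<open>t\<close> (\<open>heat_kernel_eq_conv\<close>), and \<open>\<Delta>\<close> is, up to sign,
  the product of a left and a right difference. One difference falls on each Poisson factor and costs
  \<open>t\<^bsup>-1/2\<^esup>\<close> in \<open>\<ell>\<^sup>1\<close>, by the variance of the Poisson law (\<open>nn_integral_diff_pois_le\<close>).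

  The growth condition on \<open>f\<close> only gives polynomial growth, so sums and integrals are controlled in
  exponentially weighted spaces. The base \<open>5 / 4\<close> of the weight makes \<open>e\<^bsup>t\<Delta>\<^esup>\<close> grow at most like
  \<open>e\<^bsup>t/2\<^esup>\<close>, which the factor \<open>e\<^bsup>-\<tau>\<^esup>\<close> in the Bessel potential absorbs. The growth condition for \<open>g\<close> holds
  because heat kernels act boundedly on \<open>\<ell>\<^sup>q\<close> with a polynomial weight (\<open>lp_norm_weighted_bessel_finite\<close>).
\<close>

section \<open>Convolution on the integers with exponentially decaying kernels\<close>

abbreviation counting :: "int measure" where
  "counting \<equiv> count_space UNIV"

text \<open>
  Any base \<open>c\<close> with \<open>1 < c < 3 / 2\<close> would serve: the mean of \<open>c\<^bsup>X\<^esup>\<close> for a Poisson variable \<open>X\<close> of mean \<open>t\<close> is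
  \<open>exp ((c - 1) t)\<close>, and the two Poisson factors of the heat kernel together have to stay below the factor
  \<open>exp t\<close> that the Bessel potential can absorb.
\<close>

definition geo_weight :: "int \<Rightarrow> real" where
  "geo_weight n = (5 / 4) ^ nat \<bar>n\<bar>"

definition exp_growth :: "(int \<Rightarrow> real) \<Rightarrow> bool" where
  "exp_growth f \<longleftrightarrow> (\<exists>C. \<forall>n. \<bar>f n\<bar> \<le> C * geo_weight n)"

text \<open>
  The norm of the weighted Banach algebra of kernels that act on \<open>exp_growth\<close> sequences. Values in
  \<open>[0, \<infinity>]\<close> let Tonelli's theorem give all bounds without integrability side conditions.
\<close>

definition geo_norm :: "(int \<Rightarrow> real) \<Rightarrow> ennreal" where
  "geo_norm a = (\<integral>\<^sup>+n. ennreal (geo_weight n * \<bar>a n\<bar>) \<partial>counting)"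

definition conv :: "(int \<Rightarrow> real) \<Rightarrow> (int \<Rightarrow> real) \<Rightarrow> int \<Rightarrow> real" where
  "conv a f n = (\<integral>j. a (n - j) * f j \<partial>counting)"

lemma geo_weight_pos: "geo_weight n > 0"
  by (simp add: geo_weight_def)

lemma geo_weight_ge_1: "geo_weight n \<ge> 1"
  by (simp add: geo_weight_def)

lemma geo_weight_minus [simp]: "geo_weight (- n) = geo_weight n"
  by (simp add: geo_weight_def)

lemma geo_weight_add_le: "geo_weight (m + n) \<le> geo_weight m * geo_weight n"
  unfolding geo_weight_def power_add[symmetric] by (rule power_increasing) auto

lemma nn_integral_reflect: "(\<integral>\<^sup>+j. h (n - j) \<partial>counting) = (\<integral>\<^sup>+j. h j \<partial>counting)"
  by (rule nn_integral_bij_count_space) (rule bij_betw_byWitness[where f'="\<lambda>j. n - j"], auto)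

lemma nn_integral_shift: "(\<integral>\<^sup>+j. h (j + n) \<partial>counting) = (\<integral>\<^sup>+j. h j \<partial>counting)"
  by (rule nn_integral_bij_count_space) (rule bij_betw_byWitness[where f'="\<lambda>j. j - n"], auto)

lemma integral_reflect: "(\<integral>j. h (n - j) \<partial>counting) = (\<integral>j. (h j :: real) \<partial>counting)"
  by (rule integral_bij_count_space) (rule bij_betw_byWitness[where f'="\<lambda>j. n - j"], auto)

lemma integral_shift: "(\<integral>j. h (j + n) \<partial>counting) = (\<integral>j. (h j :: real) \<partial>counting)"
  by (rule integral_bij_count_space) (rule bij_betw_byWitness[where f'="\<lambda>j. j - n"], auto)

text \<open>
  Real unconditional summability is absolute summability, and both sides are \<open>0\<close> when it fails. This
  makes Fubini's theorem for Bochner integrals available for the sums in the definitions.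
\<close>

lemma infsum_eq_integral_counting:
  fixes f :: "'a \<Rightarrow> real"
  shows "(\<Sum>\<^sub>\<infinity>j. f j) = (\<integral>j. f j \<partial>count_space UNIV)"
proof (cases "f summable_on UNIV")
  case True
  then have "Infinite_Sum.abs_summable_on f UNIV"
    using summable_on_iff_abs_summable_on_real by blast
  then show ?thesis
    using infsetsum_infsum[of f UNIV] unfolding abs_summable_equivalent infsetsum_def by simp
next
  case False
  then have "\<not> Infinite_Set_Sum.abs_summable_on f UNIV"
    unfolding abs_summable_equivalent[symmetric]
    using summable_on_iff_abs_summable_on_real by blast
  then show ?thesis using False
    by (simp add: infsum_not_exists abs_summable_on_def not_integrable_integral_eq)
qed

lemma heat_semigroup_eq_conv: "heat_semigroup t f = conv (heat_kernel t) f"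
  by (simp add: fun_eq_iff heat_semigroup_def conv_def infsum_eq_integral_counting)

lemma sigma_finite_counting: "sigma_finite_measure counting"
  by (rule sigma_finite_measure_count_space_countable) simp

interpretation counting_pair: pair_sigma_finite counting counting
  using sigma_finite_counting by (simp add: pair_sigma_finite_def)

text \<open>
  Submultiplicativity of the weight: \<open>geo_weight j\<close> is at most \<open>geo_weight n * geo_weight (n - j)\<close>, so the growth of
  \<open>f\<close> at \<open>j\<close> is charged to the point \<open>n\<close> and to the decay of the kernel at \<open>n - j\<close>.
\<close>

lemma nn_integral_geo_le:
  assumes "\<And>n. \<bar>f n\<bar> \<le> C * geo_weight n"
  shows "(\<integral>\<^sup>+j. ennreal \<bar>a (n - j) * f j\<bar> \<partial>counting) \<le> ennreal (C * geo_weight n) * geo_norm a"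
proof -
  have C: "C \<ge> 0"
    using assms[of 0] abs_ge_zero[of "f 0"] by (simp add: geo_weight_def)
  have pw: "\<bar>a (n - j) * f j\<bar> \<le> C * geo_weight n * (geo_weight (n - j) * \<bar>a (n - j)\<bar>)" for j
  proof -
    have "geo_weight j \<le> geo_weight n * geo_weight (n - j)"
      using geo_weight_add_le[of n "j - n"] geo_weight_minus[of "n - j"] by simp
    then have "\<bar>f j\<bar> \<le> C * (geo_weight n * geo_weight (n - j))"
      using assms[of j] C by (meson mult_left_mono order_trans)
    then have "\<bar>a (n - j)\<bar> * \<bar>f j\<bar> \<le> \<bar>a (n - j)\<bar> * (C * (geo_weight n * geo_weight (n - j)))"
      by (rule mult_left_mono) simp
    then show ?thesis
      by (simp add: abs_mult mult_ac)
  qed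
  have "(\<integral>\<^sup>+j. ennreal \<bar>a (n - j) * f j\<bar> \<partial>counting) \<le>
      (\<integral>\<^sup>+j. ennreal (C * geo_weight n) * ennreal (geo_weight (n - j) * \<bar>a (n - j)\<bar>) \<partial>counting)"
    using pw C by (intro nn_integral_mono)
      (simp add: ennreal_mult[symmetric] ennreal_leI less_imp_le[OF geo_weight_pos])
  also have "\<dots> = ennreal (C * geo_weight n) * geo_norm a"
    by (simp add: nn_integral_cmult geo_norm_def
      nn_integral_reflect[of "\<lambda>j. ennreal (geo_weight j * \<bar>a j\<bar>)"])
  finally show ?thesis .
qed

lemma exp_growthE:
  assumes "exp_growth f"
  obtains C where "C \<ge> 0" "\<And>n. \<bar>f n\<bar> \<le> C * geo_weight n"
proof -
  obtain C where C: "\<And>n. \<bar>f n\<bar> \<le> C * geo_weight n"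
    using assms by (auto simp: exp_growth_def)
  moreover have "C \<ge> 0" using C[of 0] abs_ge_zero[of "f 0"] by (simp add: geo_weight_def)
  ultimately show ?thesis by (rule that[rotated])
qed

lemma exp_growthI: "(\<And>n. \<bar>f n\<bar> \<le> C * geo_weight n) \<Longrightarrow> exp_growth f"
  by (auto simp: exp_growth_def)

lemma integrable_conv:
  assumes "exp_growth f" "geo_norm a < \<infinity>"
  shows "integrable counting (\<lambda>j. a (n - j) * f j)"
proof -
  obtain C where C: "C \<ge> 0" "\<And>n. \<bar>f n\<bar> \<le> C * geo_weight n"
    using assms(1) by (meson exp_growthE)
  have "(\<integral>\<^sup>+j. ennreal \<bar>a (n - j) * f j\<bar> \<partial>counting) < \<infinity>"
    using nn_integral_geo_le[of f C a n] C(2) assms(2)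
    by (auto intro: le_less_trans simp: ennreal_mult_less_top)
  then show ?thesis by (intro integrableI_bounded) auto
qed

lemma abs_conv_le_nn_integral:
  "ennreal \<bar>conv a f n\<bar> \<le> (\<integral>\<^sup>+j. ennreal \<bar>a (n - j) * f j\<bar> \<partial>counting)"
  using integral_norm_bound_ennreal[of counting "\<lambda>j. a (n - j) * f j"]
  by (cases "integrable counting (\<lambda>j. a (n - j) * f j)")
    (auto simp: conv_def not_integrable_integral_eq)

lemma conv_bound:
  assumes "\<And>n. \<bar>f n\<bar> \<le> C * geo_weight n" and "geo_norm a \<le> ennreal M" "M \<ge> 0"
  shows "\<bar>conv a f n\<bar> \<le> C * M * geo_weight n"
proof -
  have C: "C \<ge> 0"
    using assms(1)[of 0] abs_ge_zero[of "f 0"] by (simp add: geo_weight_def)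
  have "ennreal \<bar>conv a f n\<bar> \<le> ennreal (C * geo_weight n) * geo_norm a"
    using abs_conv_le_nn_integral nn_integral_geo_le[OF assms(1)] by (rule order_trans)
  also have "\<dots> \<le> ennreal (C * geo_weight n) * ennreal M"
    using assms(2) by (rule mult_left_mono) simp
  also have "\<dots> = ennreal (C * M * geo_weight n)"
    using C assms(3) by (simp add: ennreal_mult[symmetric] less_imp_le[OF geo_weight_pos] mult_ac)
  finally show ?thesis
    using C assms(3) by (simp add: ennreal_le_iff less_imp_le[OF geo_weight_pos])
qed

lemma exp_growth_conv:
  assumes "exp_growth f" "geo_norm a < \<infinity>"
  shows "exp_growth (conv a f)"
proof -
  obtain C where C: "C \<ge> 0" "\<And>n. \<bar>f n\<bar> \<le> C * geo_weight n"
    using assms(1) by (meson exp_growthE)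
  obtain M where "M \<ge> 0" "geo_norm a = ennreal M"
    using assms(2) by (cases "geo_norm a") auto
  then show ?thesis
    using conv_bound[OF C(2), of a M] by (intro exp_growthI[of _ "C * M"]) auto
qed

lemma conv_commute: "conv a c = conv c a"
proof
  fix n
  show "conv a c n = conv c a n"
    using integral_reflect[of "\<lambda>j. a (n - j) * c j" n] by (simp add: conv_def mult.commute)
qed

lemma geo_norm_conv_le: "geo_norm (conv a c) \<le> geo_norm a * geo_norm c"
proof -
  let ?A = "\<lambda>n. ennreal (geo_weight n * \<bar>a n\<bar>)" and ?C = "\<lambda>n. ennreal (geo_weight n * \<bar>c n\<bar>)"
  have pw: "ennreal (geo_weight n * \<bar>conv a c n\<bar>) \<le> (\<integral>\<^sup>+j. ?A (n - j) * ?C j \<partial>counting)" for n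
  proof -
    have "ennreal (geo_weight n * \<bar>conv a c n\<bar>) = ennreal (geo_weight n) * ennreal \<bar>conv a c n\<bar>"
      by (simp add: ennreal_mult' less_imp_le[OF geo_weight_pos])
    also have "\<dots> \<le> ennreal (geo_weight n) * (\<integral>\<^sup>+j. ennreal \<bar>a (n - j) * c j\<bar> \<partial>counting)"
      by (intro mult_left_mono abs_conv_le_nn_integral) simp
    also have "\<dots> = (\<integral>\<^sup>+j. ennreal (geo_weight n * \<bar>a (n - j) * c j\<bar>) \<partial>counting)"
      by (simp add: nn_integral_cmult[symmetric] ennreal_mult' less_imp_le[OF geo_weight_pos])
    also have "\<dots> \<le> (\<integral>\<^sup>+j. ?A (n - j) * ?C j \<partial>counting)"
    proof (intro nn_integral_mono)
      fix j
      have "geo_weight n \<le> geo_weight (n - j) * geo_weight j"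
        using geo_weight_add_le[of "n - j" j] by simp
      then have "geo_weight n * \<bar>a (n - j) * c j\<bar> \<le>
          (geo_weight (n - j) * geo_weight j) * \<bar>a (n - j) * c j\<bar>"
        by (rule mult_right_mono) simp
      then show "ennreal (geo_weight n * \<bar>a (n - j) * c j\<bar>) \<le> ?A (n - j) * ?C j"
        by (simp add: ennreal_mult[symmetric] ennreal_leI less_imp_le[OF geo_weight_pos] abs_mult mult_ac)
    qed
    finally show ?thesis .
  qed
  have "geo_norm (conv a c) \<le> (\<integral>\<^sup>+n. \<integral>\<^sup>+j. ?A (n - j) * ?C j \<partial>counting \<partial>counting)"
    unfolding geo_norm_def by (intro nn_integral_mono pw)
  also have "\<dots> = (\<integral>\<^sup>+j. \<integral>\<^sup>+n. ?A (n - j) * ?C j \<partial>counting \<partial>counting)"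
    by (rule nn_integral_count_space_nn_integral) auto
  also have "\<dots> = (\<integral>\<^sup>+j. geo_norm a * ?C j \<partial>counting)"
    using nn_integral_shift[where h="?A" and n="- _"]
    by (simp add: nn_integral_multc geo_norm_def)
  also have "\<dots> = geo_norm a * geo_norm c"
    by (simp add: nn_integral_cmult geo_norm_def)
  finally show ?thesis .
qed

text \<open>
  Fubini's theorem; the double sum converges absolutely by two applications of \<open>nn_integral_geo_le\<close>.
\<close>

lemma conv_assoc:
  assumes "exp_growth f" "geo_norm a < \<infinity>" "geo_norm c < \<infinity>"
  shows "conv (conv a c) f = conv a (conv c f)"
proof
  fix n
  obtain C where C: "C \<ge> 0" "\<And>n. \<bar>f n\<bar> \<le> C * geo_weight n"
    using assms(1) by (meson exp_growthE)
  obtain M where M: "M \<ge> 0" "geo_norm c = ennreal M"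
    using assms(3) by (cases "geo_norm c") auto
  let ?h = "\<lambda>k j. a (n - k) * (c (k - j) * f j)"
  have int: "integrable (counting \<Otimes>\<^sub>M counting) (case_prod ?h)"
  proof (rule integrableI_bounded)
    have "(\<integral>\<^sup>+x. ennreal (norm (case x of (k, j) \<Rightarrow> ?h k j)) \<partial>(counting \<Otimes>\<^sub>M counting))
      = (\<integral>\<^sup>+k. \<integral>\<^sup>+j. ennreal \<bar>?h k j\<bar> \<partial>counting \<partial>counting)"
      by (subst sigma_finite_measure.nn_integral_fst[OF sigma_finite_counting, symmetric]) (auto simp: pair_measure_countable)
    also have "\<dots> = (\<integral>\<^sup>+k. ennreal \<bar>a (n - k)\<bar> * (\<integral>\<^sup>+j. ennreal \<bar>c (k - j) * f j\<bar> \<partial>counting) \<partial>counting)"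
      by (simp add: abs_mult ennreal_mult' nn_integral_cmult mult.assoc)
    also have "\<dots> \<le> (\<integral>\<^sup>+k. ennreal \<bar>a (n - k)\<bar> * (ennreal (C * geo_weight k) * ennreal M) \<partial>counting)"
      using nn_integral_geo_le[OF C(2), of c] M(2) by (intro nn_integral_mono mult_left_mono) auto
    also have "\<dots> = (\<integral>\<^sup>+k. ennreal \<bar>a (n - k) * (C * M * geo_weight k)\<bar> \<partial>counting)"
      using C(1) M(1) by (intro nn_integral_cong)
        (simp add: abs_mult ennreal_mult less_imp_le[OF geo_weight_pos] mult_ac)
    also have "\<dots> \<le> ennreal (C * M * geo_weight n) * geo_norm a"
      using C(1) M(1) by (intro nn_integral_geo_le) (simp add: abs_mult less_imp_le[OF geo_weight_pos])
    also have "\<dots> < \<infinity>"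
      using assms(2) by (simp add: ennreal_mult_less_top)
    finally show "(\<integral>\<^sup>+x. ennreal (norm (case x of (k, j) \<Rightarrow> ?h k j)) \<partial>(counting \<Otimes>\<^sub>M counting)) < \<infinity>" .
  qed (simp add: pair_measure_countable)
  have inner: "conv a c (n - j) = (\<integral>k. a (n - k) * c (k - j) \<partial>counting)" for j
    using integral_shift[of "\<lambda>k. a (n - k) * c (k - j)" j] by (simp add: conv_def algebra_simps)
  have "conv (conv a c) f n = (\<integral>j. (\<integral>k. ?h k j \<partial>counting) \<partial>counting)"
    unfolding conv_def[of "conv a c"] inner integral_mult_left_zero[symmetric] by (simp add: mult.assoc)
  also have "\<dots> = (\<integral>k. (\<integral>j. ?h k j \<partial>counting) \<partial>counting)"
    by (rule counting_pair.Fubini_integral[OF int])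
  also have "\<dots> = conv a (conv c f) n"
    by (simp add: conv_def)
  finally show "conv (conv a c) f n = conv a (conv c f) n" .
qed

lemma geo_norm_finite_exp_growth:
  assumes "geo_norm a < \<infinity>"
  shows "exp_growth a"
proof -
  obtain M where M: "M \<ge> 0" "geo_norm a = ennreal M"
    using assms by (cases "geo_norm a") auto
  have "\<bar>a n\<bar> \<le> M * geo_weight n" for n
  proof -
    have "ennreal (geo_weight n * \<bar>a n\<bar>) \<le> geo_norm a"
      unfolding geo_norm_def by (rule nn_integral_ge_point) simp
    then have "geo_weight n * \<bar>a n\<bar> \<le> M"
      using M by simp
    moreover have "\<bar>a n\<bar> \<le> geo_weight n * \<bar>a n\<bar>"
      using mult_right_mono[OF geo_weight_ge_1, of "\<bar>a n\<bar>"] by simp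
    moreover have "M \<le> M * geo_weight n"
      using mult_left_mono[OF geo_weight_ge_1 M(1)] by simp
    ultimately show ?thesis by linarith
  qed
  then show ?thesis by (rule exp_growthI)
qed

definition lap :: "(int \<Rightarrow> real) \<Rightarrow> int \<Rightarrow> real" where
  "lap f n = f (n + 1) - 2 * f n + f (n - 1)"

lemma exp_growth_shift:
  assumes "exp_growth f"
  shows "exp_growth (\<lambda>n. f (n + d))"
proof -
  obtain C where C: "C \<ge> 0" "\<And>n. \<bar>f n\<bar> \<le> C * geo_weight n"
    using assms by (meson exp_growthE)
  have "\<bar>f (n + d)\<bar> \<le> (C * geo_weight d) * geo_weight n" for n
    using order_trans[OF C(2) mult_left_mono[OF geo_weight_add_le[of n d] C(1)]] by (simp add: mult_ac)
  then show ?thesis by (rule exp_growthI)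
qed

lemma exp_growth_add:
  assumes "exp_growth f" "exp_growth g"
  shows "exp_growth (\<lambda>n. f n + g n)"
proof -
  obtain C D where "\<And>n. \<bar>f n\<bar> \<le> C * geo_weight n" "\<And>n. \<bar>g n\<bar> \<le> D * geo_weight n"
    using assms by (meson exp_growthE)
  then have "\<bar>f n + g n\<bar> \<le> (C + D) * geo_weight n" for n
    using abs_triangle_ineq[of "f n" "g n"] by (simp add: distrib_right) (meson add_mono order_trans)
  then show ?thesis by (rule exp_growthI)
qed

lemma exp_growth_cmult:
  assumes "exp_growth f"
  shows "exp_growth (\<lambda>n. c * f n)"
proof -
  obtain C where "\<And>n. \<bar>f n\<bar> \<le> C * geo_weight n"
    using assms by (meson exp_growthE)
  then have "\<bar>c * f n\<bar> \<le> (\<bar>c\<bar> * C) * geo_weight n" for n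
    by (simp add: abs_mult mult.assoc mult_left_mono)
  then show ?thesis by (rule exp_growthI)
qed

lemma exp_growth_lap:
  assumes "exp_growth f"
  shows "exp_growth (lap f)"
proof -
  have "exp_growth (\<lambda>n. f (n + 1) + (-2) * f n + f (n + - 1))"
    by (intro exp_growth_add exp_growth_shift exp_growth_cmult assms)
  then show ?thesis by (simp add: lap_def[abs_def] add_ac)
qed

lemma exp_growth_lap_power: "exp_growth f \<Longrightarrow> exp_growth ((lap ^^ k) f)"
  by (induction k) (auto intro: exp_growth_lap)

lemma conv_shift: "conv a (\<lambda>n. f (n + d)) n = conv a f (n + d)"
  using integral_shift[of "\<lambda>j. a (n + d - j) * f j" d] by (simp add: conv_def algebra_simps)

lemma conv_lap:
  assumes "exp_growth f" "geo_norm a < \<infinity>"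
  shows "conv a (lap f) = lap (conv a f)"
proof
  fix n
  have int: "integrable counting (\<lambda>j. a (n - j) * f (j + d))" for d
    by (rule integrable_conv[OF exp_growth_shift[OF assms(1)] assms(2)])
  have "conv a (lap f) n = (\<integral>j. a (n - j) * f (j + 1) - 2 * (a (n - j) * f (j + 0))
      + a (n - j) * f (j + (-1)) \<partial>counting)"
    by (simp add: conv_def lap_def algebra_simps)
  also have "\<dots> = conv a (\<lambda>n. f (n + 1)) n - 2 * conv a (\<lambda>n. f (n + 0)) n + conv a (\<lambda>n. f (n + (-1))) n"
    unfolding conv_def using int[of 1] int[of 0] int[of "-1"] by simp
  also have "\<dots> = lap (conv a f) n"
    by (simp only: conv_shift lap_def) simp
  finally show "conv a (lap f) n = lap (conv a f) n" .
qed

lemma conv_lap_power: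
  assumes "exp_growth f" "geo_norm a < \<infinity>"
  shows "conv a ((lap ^^ k) f) = (lap ^^ k) (conv a f)"
  using assms by (induction k) (auto simp: conv_lap exp_growth_lap_power)

section \<open>The heat kernel as a convolution of two Poisson kernels\<close>

text \<open>
  The Poisson distribution of mean \<open>t\<close>, extended by zero to the integers so that it is a convolution kernel.
\<close>

definition pois :: "real \<Rightarrow> int \<Rightarrow> real" where
  "pois t m = (if m \<ge> 0 then exp (- t) * t ^ nat m / fact (nat m) else 0)"

lemma pois_int [simp]: "pois t (int m) = exp (- t) * t ^ m / fact m"
  by (simp add: pois_def)

lemma pois_neg: "m < 0 \<Longrightarrow> pois t m = 0"
  by (simp add: pois_def)

lemma bij_betw_int_nonneg: "bij_betw int UNIV {0..}"
  by (rule bij_betw_byWitness[where f'=nat]) auto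

lemma nn_integral_counting_nat:
  assumes "\<And>j. j < 0 \<Longrightarrow> h j = 0"
  shows "(\<integral>\<^sup>+j. h j \<partial>counting) = (\<Sum>m. h (int m))"
proof -
  have "(\<integral>\<^sup>+j. h j \<partial>counting) = (\<integral>\<^sup>+j. h j * indicator {0..} j \<partial>counting)"
    using assms by (intro nn_integral_cong) (auto simp: indicator_def not_le)
  also have "\<dots> = (\<integral>\<^sup>+m. h (int m) \<partial>count_space UNIV)"
    by (simp add: nn_integral_count_space_indicator[symmetric]
      nn_integral_bij_count_space[OF bij_betw_int_nonneg])
  finally show ?thesis by (simp add: nn_integral_count_space_nat)
qed

lemma integral_counting_nat:
  fixes h :: "int \<Rightarrow> real"
  assumes "\<And>j. j < 0 \<Longrightarrow> h j = 0"
  shows "(\<integral>j. h j \<partial>counting) = (\<integral>m. h (int m) \<partial>count_space UNIV)"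
proof -
  have "(\<integral>j. h j \<partial>counting) = (\<integral>j. indicator {0..} j *\<^sub>R h j \<partial>counting)"
    using assms by (intro Bochner_Integration.integral_cong) (auto simp: indicator_def not_le)
  also have "\<dots> = (\<integral>j. h j \<partial>restrict_space counting {0..})"
    by (rule integral_restrict_space[symmetric]) simp
  also have "restrict_space counting {0..} = count_space {0::int..}"
    by (rule restrict_count_space_subset) simp
  also have "(\<integral>j. h j \<partial>count_space {0..}) = (\<integral>m. h (int m) \<partial>count_space UNIV)"
    by (rule integral_bij_count_space[OF bij_betw_int_nonneg, symmetric])
  finally show ?thesis .
qed

lemma integrable_counting_nat:
  fixes h :: "int \<Rightarrow> real"
  assumes "\<And>j. j < 0 \<Longrightarrow> h j = 0" "integrable counting h"
  shows "integrable (count_space UNIV) (\<lambda>m. h (int m))"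
proof (rule integrableI_bounded)
  have "(\<integral>\<^sup>+m. ennreal (norm (h (int m))) \<partial>count_space UNIV) = (\<integral>\<^sup>+j. ennreal (norm (h j)) \<partial>counting)"
    unfolding nn_integral_count_space_nat
    by (rule nn_integral_counting_nat[symmetric]) (simp add: assms(1))
  also have "\<dots> < \<infinity>"
    using assms(2) unfolding integrable_iff_bounded by blast
  finally show "(\<integral>\<^sup>+m. ennreal (norm (h (int m))) \<partial>count_space UNIV) < \<infinity>" .
qed simp

lemma geo_norm_reflect: "geo_norm (\<lambda>n. a (- n)) = geo_norm a"
  using nn_integral_reflect[of "\<lambda>j. ennreal (geo_weight j * \<bar>a j\<bar>)" 0] by (simp add: geo_norm_def)

lemma geo_norm_pois:
  assumes "t \<ge> 0"
  shows "geo_norm (pois t) = ennreal (exp (t / 4))"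
proof -
  have "(\<lambda>m. exp (- t) * ((5 / 4 * t) ^ m /\<^sub>R fact m)) sums (exp (- t) * exp (5 / 4 * t))"
    by (intro sums_mult exp_converges)
  also have "(\<lambda>m. exp (- t) * ((5 / 4 * t) ^ m /\<^sub>R fact m)) =
      (\<lambda>m. geo_weight (int m) * \<bar>pois t (int m)\<bar>)"
    using assms by (simp add: fun_eq_iff geo_weight_def power_mult_distrib field_simps)
  also have "exp (- t) * exp (5 / 4 * t) = exp (t / 4)"
    by (simp add: exp_add[symmetric])
  finally have "(\<Sum>m. ennreal (geo_weight (int m) * \<bar>pois t (int m)\<bar>)) = ennreal (exp (t / 4))"
    by (intro suminf_ennreal_eq) (simp_all add: less_imp_le[OF geo_weight_pos])
  then show ?thesis
    unfolding geo_norm_def by (subst nn_integral_counting_nat) (simp_all add: pois_neg)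
qed

text \<open>
  First and second moments of the Poisson distribution, without the normalising factor \<open>exp (- t)\<close>.
\<close>

lemma sums_pois_mean: "(\<lambda>m. real m * (t ^ m / fact m)) sums (t * exp t)"
proof -
  have "(\<lambda>k. t * (t ^ k /\<^sub>R fact k)) sums (t * exp t)"
    by (intro sums_mult exp_converges)
  also have "(\<lambda>k. t * (t ^ k /\<^sub>R fact k)) = (\<lambda>k. real (Suc k) * (t ^ Suc k / fact (Suc k)))"
    by (simp add: fun_eq_iff field_simps del: of_nat_Suc)
  finally show ?thesis by (subst (asm) sums_Suc_iff) simp
qed

lemma sums_pois_square: "(\<lambda>m. real m ^ 2 * (t ^ m / fact m)) sums (t * (t * exp t + exp t))"
proof -
  have "(\<lambda>k. t * (real k * (t ^ k / fact k) + t ^ k /\<^sub>R fact k)) sums (t * (t * exp t + exp t))"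
    by (intro sums_mult sums_add exp_converges sums_pois_mean)
  also have "(\<lambda>k. t * (real k * (t ^ k / fact k) + t ^ k /\<^sub>R fact k)) =
      (\<lambda>k. real (Suc k) ^ 2 * (t ^ Suc k / fact (Suc k)))"
    by (simp add: fun_eq_iff divide_simps power2_eq_square) (simp add: algebra_simps)
  finally show ?thesis by (subst (asm) sums_Suc_iff) simp
qed

definition diff_left :: "(int \<Rightarrow> real) \<Rightarrow> int \<Rightarrow> real" where
  "diff_left f n = f n - f (n - 1)"

definition diff_right :: "(int \<Rightarrow> real) \<Rightarrow> int \<Rightarrow> real" where
  "diff_right f n = f n - f (n + 1)"

text \<open>
  The difference of the Poisson weights is \<open>pois t m * (1 - m / t)\<close>, so its \<open>\<ell>\<^sup>1\<close> norm is the mean of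
  \<open>\<bar>1 - X / t\<bar>\<close> for a Poisson variable \<open>X\<close> of mean and variance \<open>t\<close>. The bound
  \<open>2 x \<le> sqrt t * x\<^sup>2 + 1 / sqrt t\<close> reduces it to the variance of \<open>X / t\<close>, which is \<open>1 / t\<close>.
\<close>

lemma nn_integral_diff_pois_le:
  assumes "t > 0"
  shows "(\<integral>\<^sup>+m. ennreal \<bar>diff_left (pois t) m\<bar> \<partial>counting) \<le> ennreal (1 / sqrt t)"
proof -
  let ?b = "\<lambda>m::nat. exp (- t) / 2 * (sqrt t * (t ^ m /\<^sub>R fact m - 2 / t * (real m * (t ^ m / fact m))
      + 1 / t\<^sup>2 * (real m ^ 2 * (t ^ m / fact m))) + 1 / sqrt t * (t ^ m /\<^sub>R fact m))"
  have eq: "diff_left (pois t) (int m) = exp (- t) * (t ^ m / fact m) * (1 - real m / t)" for m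
  proof (cases m)
    case (Suc k)
    have "pois t (int m - 1) = exp (- t) * t ^ k / fact k"
      using pois_int[of t k] Suc by simp
    moreover have "pois t (int m) = exp (- t) * t ^ Suc k / fact (Suc k)"
      by (simp only: Suc pois_int)
    ultimately have "diff_left (pois t) (int m) = exp (- t) * t ^ Suc k / fact (Suc k) - exp (- t) * t ^ k / fact k"
      by (simp add: diff_left_def)
    then show ?thesis using assms Suc by (simp add: divide_simps) (simp add: algebra_simps)
  qed (simp add: diff_left_def pois_def)
  have "?b sums (exp (- t) / 2 * (sqrt t * (exp t - 2 / t * (t * exp t) + 1 / t\<^sup>2 * (t * (t * exp t + exp t)))
      + 1 / sqrt t * exp t))"
    by (intro sums_mult sums_add sums_diff exp_converges sums_pois_mean sums_pois_square)
  also have "exp (- t) / 2 * (sqrt t * (exp t - 2 / t * (t * exp t) + 1 / t\<^sup>2 * (t * (t * exp t + exp t)))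
      + 1 / sqrt t * exp t) = (sqrt t * (1 / t) + 1 / sqrt t) / 2"
    using assms by (simp add: exp_minus divide_simps power2_eq_square)
  also have "\<dots> = 1 / sqrt t"
    using assms by (simp add: divide_simps)
  finally have b: "?b sums (1 / sqrt t)" .
  have ring: "e * P * ((r * (1 - u * a + v * b) + w) / 2) =
      e / 2 * (r * (P - u * (a * P) + v * (b * P)) + w * P)" for e P r u a v b w :: real
    by (simp add: field_simps)
  have scale: "t ^ m /\<^sub>R fact m = t ^ m / fact m" for m
    by (simp add: field_simps)
  have le: "\<bar>diff_left (pois t) (int m)\<bar> \<le> ?b m" for m
  proof -
    define x where "x = \<bar>1 - real m / t\<bar>"
    have "0 \<le> (sqrt t * x - 1)\<^sup>2" by simp
    then have "2 * x * sqrt t \<le> t * x\<^sup>2 + 1"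
      using assms by (simp add: power2_eq_square algebra_simps)
    moreover have "sqrt t * sqrt t = t"
      using assms by simp
    then have "sqrt t * (sqrt t * x\<^sup>2) = t * x\<^sup>2"
      by (simp only: mult.assoc[symmetric])
    ultimately have "x * (sqrt t * 2) \<le> 1 + sqrt t * (sqrt t * x\<^sup>2)"
      by (simp only: mult_ac add_ac)
    then have "x \<le> (sqrt t * x\<^sup>2 + 1 / sqrt t) / 2"
      using assms by (simp add: field_simps)
    then have "exp (- t) * (t ^ m / fact m) * x \<le>
        exp (- t) * (t ^ m / fact m) * ((sqrt t * x\<^sup>2 + 1 / sqrt t) / 2)"
      using assms by (intro mult_left_mono) auto
    also have "x\<^sup>2 = 1 - 2 / t * real m + 1 / t\<^sup>2 * (real m)\<^sup>2"
      using assms by (simp add: x_def power2_eq_square) (simp add: field_simps)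
    also have "exp (- t) * (t ^ m / fact m) * ((sqrt t * (1 - 2 / t * real m + 1 / t\<^sup>2 * (real m)\<^sup>2)
        + 1 / sqrt t) / 2) = ?b m"
      using ring[of "exp (- t)" "t ^ m / fact m" "sqrt t" "2 / t" "real m" "1 / t\<^sup>2" "(real m)\<^sup>2" "1 / sqrt t"]
      by (simp only: scale)
    finally show ?thesis
      using assms by (simp add: eq abs_mult x_def)
  qed
  have "(\<integral>\<^sup>+m. ennreal \<bar>diff_left (pois t) m\<bar> \<partial>counting) = (\<Sum>m. ennreal \<bar>diff_left (pois t) (int m)\<bar>)"
    by (rule nn_integral_counting_nat) (simp add: diff_left_def pois_neg)
  also have "\<dots> \<le> (\<Sum>m. ennreal (?b m))"
    by (intro suminf_le ennreal_leI le) auto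
  also have "\<dots> = ennreal (1 / sqrt t)"
    by (intro suminf_ennreal_eq b) (rule order_trans[OF abs_ge_zero le])
  finally show ?thesis .
qed

text \<open>
  Sums of independent Poisson variables are Poisson, by the binomial theorem.
\<close>

lemma conv_pois:
  assumes "s \<ge> 0" "t \<ge> 0"
  shows "conv (pois s) (pois t) = pois (s + t)"
proof
  fix n
  show "conv (pois s) (pois t) n = pois (s + t) n"
  proof (cases "n < 0")
    case True
    then have "pois s (n - j) * pois t j = 0" for j
      by (cases "j < 0") (auto simp: pois_neg)
    then have "conv (pois s) (pois t) n = (\<integral>j. 0 \<partial>counting)"
      unfolding conv_def by (intro Bochner_Integration.integral_cong) auto
    then show ?thesis using True by (simp add: pois_neg)
  next
    case False
    define N where "N = nat n"
    then have n: "n = int N" using False by simp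
    let ?h = "\<lambda>m. pois s (int N - int m) * pois t (int m)"
    have zero: "?h m = 0" if "m > N" for m
      using that by (simp add: pois_neg)
    have "conv (pois s) (pois t) n = (\<integral>m. ?h m \<partial>count_space UNIV)"
      unfolding conv_def n by (rule integral_counting_nat) (simp add: pois_neg)
    also have "\<dots> = (\<Sum>m | m \<in> UNIV \<and> ?h m \<noteq> 0. ?h m)"
      by (rule lebesgue_integral_count_space_finite_support)
        (rule finite_subset[of _ "{..N}"], use zero not_less in \<open>auto simp del: pois_int\<close>)
    also have "\<dots> = (\<Sum>m\<le>N. ?h m)"
      by (rule sum.mono_neutral_left) (use zero not_less in \<open>auto simp del: pois_int\<close>)
    also have "\<dots> = (\<Sum>m\<le>N. exp (- (s + t)) / fact N * (real (N choose m) * t ^ m * s ^ (N - m)))"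
    proof (intro sum.cong refl)
      fix m assume "m \<in> {..N}"
      then have m: "m \<le> N" by simp
      then have "?h m = (exp (- s) * s ^ (N - m) / fact (N - m)) * (exp (- t) * t ^ m / fact m)"
        by (simp only: pois_int of_nat_diff[symmetric])
      moreover have "exp (- (s + t)) = exp (- s) * exp (- t)"
        by (simp add: exp_add[symmetric])
      moreover have "real (N choose m) = fact N / (fact m * fact (N - m))"
        by (rule binomial_fact[OF m])
      ultimately show "?h m = exp (- (s + t)) / fact N * (real (N choose m) * t ^ m * s ^ (N - m))"
        by (simp only:) (simp add: mult_ac)
    qed
    also have "\<dots> = exp (- (s + t)) / fact N * (t + s) ^ N"
      by (simp add: binomial_ring sum_distrib_left)
    finally show ?thesis by (simp add: n add.commute)
  qed
qed

abbreviation pois_refl :: "real \<Rightarrow> int \<Rightarrow> real" where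
  "pois_refl t \<equiv> (\<lambda>n. pois t (- n))"

lemma conv_reflect: "conv (\<lambda>n. a (- n)) (\<lambda>n. c (- n)) = (\<lambda>n. conv a c (- n))"
proof
  fix n
  show "conv (\<lambda>n. a (- n)) (\<lambda>n. c (- n)) n = conv a c (- n)"
    using integral_reflect[of "\<lambda>j. a (- n - j) * c j" 0] by (simp add: conv_def)
qed

text \<open>
  In the power series of the Bessel function, the \<open>m\<close>-th term is \<open>t\<^bsup>m\<^esup> / m!\<close> times \<open>t\<^bsup>m+n\<^esup> / (m+n)!\<close>: up to
  \<open>exp (- 2 t)\<close> the product of the Poisson weights of \<open>m + n\<close> and \<open>m\<close>, with difference \<open>n\<close>. The reciprocal Gamma
  function vanishes exactly when \<open>m + n\<close> is outside the support of the Poisson law.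
\<close>

lemma heat_kernel_eq_conv:
  assumes "t > 0"
  shows "heat_kernel t = conv (pois t) (pois_refl t)"
proof
  fix n
  let ?h = "\<lambda>j. pois t (n + j) * pois t j"
  have fin: "geo_norm (pois t) < \<infinity>" "exp_growth (pois_refl t)"
    using assms by (auto intro!: geo_norm_finite_exp_growth simp: geo_norm_pois geo_norm_reflect)
  have int: "integrable counting (\<lambda>j. pois t (n - j) * pois_refl t j)"
    by (rule integrable_conv) (use fin in auto)
  have "integrable counting ?h"
  proof -
    have "integrable counting (\<lambda>j. pois t (n - (0 - j)) * pois_refl t (0 - j))"
      by (subst integrable_bij_count_space[where g="\<lambda>j. 0 - j" and B=UNIV])
        (use int in \<open>auto intro!: bij_betw_byWitness[where f'="\<lambda>j. 0 - j"]\<close>)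
    then show ?thesis by simp
  qed
  then have int_nat: "integrable (count_space UNIV) (\<lambda>m. ?h (int m))"
    by (rule integrable_counting_nat[rotated]) (simp add: pois_neg)
  let ?B = "\<lambda>m. (2 * t / 2) powi (2 * int m + n) * rGamma (of_int (int m + n + 1)) / fact m"
  have B: "?h (int m) = exp (- 2 * t) * ?B m" for m
  proof (cases "n + int m < 0")
    case True
    then have "real_of_int (int m + n + 1) \<in> \<int>\<^sub>\<le>\<^sub>0"
      by (intro nonpos_Ints_of_int) auto
    then have "rGamma (real_of_int (int m + n + 1)) = 0"
      using rGamma_eq_zero_iff by blast
    then show ?thesis using True by (simp add: pois_neg)
  next
    case False
    define k where "k = nat (n + int m)"
    then have k: "n + int m = int k" using False by simp
    have "int m + n + 1 = 1 + int k" using k by simp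
    then have "real_of_int (int m + n + 1) = 1 + of_nat k"
      by (simp only: of_int_add of_int_1 of_int_of_nat_eq)
    then have g: "rGamma (real_of_int (int m + n + 1)) = 1 / fact k"
      by (simp only: rGamma_inverse_Gamma Gamma_fact inverse_eq_divide)
    have "2 * int m + n = int (m + k)" using k by linarith
    then have "t powi (2 * int m + n) = t ^ m * t ^ k"
      by (simp only: power_int_of_nat power_add)
    moreover have "exp (- 2 * t) = exp (- t) * exp (- t)"
      by (simp add: exp_add[symmetric])
    moreover have "?h (int m) = (exp (- t) * t ^ k / fact k) * (exp (- t) * t ^ m / fact m)"
      by (simp only: k pois_int)
    moreover have "2 * t / 2 = t" by simp
    ultimately show ?thesis by (simp only: g) (simp add: mult_ac)
  qed
  have "summable (\<lambda>m. ?h (int m))"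
    using int_nat by (simp add: integrable_count_space_nat_iff summable_rabs_cancel)
  then have summable_B: "summable ?B"
    unfolding B by (simp only: summable_cmult_iff) simp
  have "conv (pois t) (pois_refl t) n = (\<integral>j. ?h j \<partial>counting)"
    using integral_reflect[of "\<lambda>j. pois t (n - j) * pois_refl t j" 0] by (simp add: conv_def)
  also have "\<dots> = (\<integral>m. ?h (int m) \<partial>count_space UNIV)"
    by (rule integral_counting_nat) (simp add: pois_neg)
  also have "\<dots> = (\<Sum>m. ?h (int m))"
    by (rule integral_count_space_nat[OF int_nat])
  also have "\<dots> = (\<Sum>m. exp (- 2 * t) * ?B m)"
    by (simp only: B)
  also have "\<dots> = exp (- 2 * t) * bessel_I n (2 * t)"
    unfolding bessel_I_def by (rule suminf_mult[OF summable_B])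
  finally show "heat_kernel t n = conv (pois t) (pois_refl t) n"
    by (simp add: heat_kernel_def)
qed

section \<open>The heat semigroup and its time derivatives\<close>

lemma geo_norm_pois_finite: "t \<ge> 0 \<Longrightarrow> geo_norm (pois t) < \<infinity>"
  by (simp add: geo_norm_pois)

lemma geo_norm_pois_refl_finite: "t \<ge> 0 \<Longrightarrow> geo_norm (pois_refl t) < \<infinity>"
  by (simp add: geo_norm_pois geo_norm_reflect)

lemma geo_norm_heat_kernel_le:
  assumes "t > 0"
  shows "geo_norm (heat_kernel t) \<le> ennreal (exp (t / 2))"
proof -
  have "geo_norm (heat_kernel t) \<le> geo_norm (pois t) * geo_norm (pois_refl t)"
    unfolding heat_kernel_eq_conv[OF assms] by (rule geo_norm_conv_le)
  also have "\<dots> = ennreal (exp (t / 2))"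
    using assms by (simp add: geo_norm_reflect geo_norm_pois ennreal_mult[symmetric] exp_add[symmetric])
  finally show ?thesis .
qed

lemma geo_norm_heat_kernel_finite: "t > 0 \<Longrightarrow> geo_norm (heat_kernel t) < \<infinity>"
  using geo_norm_heat_kernel_le[of t] by (simp add: le_less_trans)

lemma heat_semigroup_eq_pois:
  assumes "t > 0" "exp_growth f"
  shows "heat_semigroup t f = conv (pois t) (conv (pois_refl t) f)"
  unfolding heat_semigroup_eq_conv heat_kernel_eq_conv[OF assms(1)]
  using assms less_imp_le by (intro conv_assoc geo_norm_pois_finite geo_norm_pois_refl_finite) auto

lemma exp_growth_heat:
  assumes "t > 0" "exp_growth f"
  shows "exp_growth (heat_semigroup t f)"
  unfolding heat_semigroup_eq_conv by (intro exp_growth_conv geo_norm_heat_kernel_finite assms)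

lemma abs_heat_le:
  assumes "t > 0" "\<And>n. \<bar>f n\<bar> \<le> C * geo_weight n"
  shows "\<bar>heat_semigroup t f n\<bar> \<le> C * exp (t / 2) * geo_weight n"
  unfolding heat_semigroup_eq_conv
  using assms geo_norm_heat_kernel_le by (intro conv_bound) auto

lemma conv_left_commute:
  assumes "exp_growth f" "geo_norm a < \<infinity>" "geo_norm c < \<infinity>"
  shows "conv a (conv c f) = conv c (conv a f)"
  using conv_assoc[OF assms] conv_assoc[OF assms(1,3,2)] conv_commute[of a c] by simp

text \<open>
  The four Poisson factors commute; regrouping them reduces the claim to the Poisson semigroup law.
\<close>

lemma heat_semigroup_add:
  assumes "s > 0" "t > 0" "exp_growth f"
  shows "heat_semigroup (s + t) f = heat_semigroup s (heat_semigroup t f)"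
proof -
  note fin = geo_norm_pois_finite[OF less_imp_le[OF assms(1)]] geo_norm_pois_finite[OF less_imp_le[OF assms(2)]]
    geo_norm_pois_refl_finite[OF less_imp_le[OF assms(1)]] geo_norm_pois_refl_finite[OF less_imp_le[OF assms(2)]]
  have g: "exp_growth (conv (pois_refl t) f)" "exp_growth (conv (pois t) (conv (pois_refl t) f))"
    "exp_growth (conv (pois_refl s) (conv (pois_refl t) f))"
    using assms fin by (auto intro!: exp_growth_conv)
  have "heat_semigroup s (heat_semigroup t f) =
      conv (pois s) (conv (pois_refl s) (conv (pois t) (conv (pois_refl t) f)))"
    using assms g by (simp add: heat_semigroup_eq_pois)
  also have "\<dots> = conv (pois s) (conv (pois t) (conv (pois_refl s) (conv (pois_refl t) f)))"
    using g(1) fin by (simp only: conv_left_commute[of "conv (pois_refl t) f" "pois_refl s" "pois t"])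
  also have "\<dots> = conv (conv (pois s) (pois t)) (conv (conv (pois_refl s) (pois_refl t)) f)"
    using g fin assms(3) by (simp only: conv_assoc)
  also have "\<dots> = conv (pois (s + t)) (conv (pois_refl (s + t)) f)"
    using assms by (simp add: conv_pois conv_reflect)
  also have "\<dots> = heat_semigroup (s + t) f"
    using assms by (simp add: heat_semigroup_eq_pois)
  finally show ?thesis by simp
qed

lemma heat_lap_power:
  assumes "t > 0" "exp_growth f"
  shows "heat_semigroup t ((lap ^^ k) f) = (lap ^^ k) (heat_semigroup t f)"
  unfolding heat_semigroup_eq_conv by (intro conv_lap_power geo_norm_heat_kernel_finite assms)

text \<open>
  Summation by parts: a difference can be moved from the sequence to the kernel.
\<close>

lemma conv_diff_left:
  assumes "exp_growth f" "geo_norm a < \<infinity>"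
  shows "conv a (diff_left f) = conv (diff_left a) f"
proof
  fix n
  have i: "integrable counting (\<lambda>j. a (n - j) * f j)" "integrable counting (\<lambda>j. a (n - 1 - j) * f j)"
    "integrable counting (\<lambda>j. a (n - j) * f (j + - 1))"
    by (intro integrable_conv assms exp_growth_shift)+
  have "conv a (diff_left f) n = conv a f n - conv a (\<lambda>n. f (n + - 1)) n"
    using i(1,3) by (simp add: conv_def diff_left_def right_diff_distrib)
  also have "\<dots> = conv a f n - conv a f (n - 1)"
    unfolding conv_shift by simp
  also have "\<dots> = conv (diff_left a) f n"
    using i(1,2) by (simp add: conv_def diff_left_def left_diff_distrib algebra_simps)
  finally show "conv a (diff_left f) n = conv (diff_left a) f n" .
qed

lemma conv_diff_right:
  assumes "exp_growth f" "geo_norm a < \<infinity>"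
  shows "conv a (diff_right f) = conv (diff_right a) f"
proof
  fix n
  have i: "integrable counting (\<lambda>j. a (n - j) * f j)" "integrable counting (\<lambda>j. a (n + 1 - j) * f j)"
    "integrable counting (\<lambda>j. a (n - j) * f (j + 1))"
    by (intro integrable_conv assms exp_growth_shift)+
  have "conv a (diff_right f) n = conv a f n - conv a (\<lambda>n. f (n + 1)) n"
    using i(1,3) by (simp add: conv_def diff_right_def right_diff_distrib)
  also have "\<dots> = conv a f n - conv a f (n + 1)"
    unfolding conv_shift by simp
  also have "\<dots> = conv (diff_right a) f n"
    using i(1,2) by (simp add: conv_def diff_right_def left_diff_distrib algebra_simps)
  finally show "conv a (diff_right f) n = conv (diff_right a) f n" .
qed

lemma exp_growth_diff_left:
  assumes "exp_growth f" shows "exp_growth (diff_left f)"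
proof -
  have "exp_growth (\<lambda>n. f n + (-1) * f (n + - 1))"
    by (intro exp_growth_add exp_growth_cmult exp_growth_shift assms)
  then show ?thesis by (simp add: diff_left_def[abs_def])
qed

text \<open>
  \<open>\<Delta>\<close> is minus the composition of the left and the right difference. One of them is moved to each Poisson
  factor of the heat kernel, which makes \<open>nn_integral_diff_pois_le\<close> applicable twice.
\<close>

lemma heat_lap_eq:
  assumes "t > 0" "exp_growth f"
  shows "heat_semigroup t (lap f) n =
    - conv (diff_left (pois t)) (conv (diff_right (pois_refl t)) f) n"
proof -
  let ?p = "pois t" and ?q = "pois_refl t"
  have fin: "geo_norm ?p < \<infinity>" "geo_norm ?q < \<infinity>"
    using assms geo_norm_pois_finite geo_norm_pois_refl_finite by auto
  have lap: "lap f = (\<lambda>n. - diff_left (diff_right f) n)"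
    by (simp add: fun_eq_iff lap_def diff_left_def diff_right_def)
  have right: "exp_growth (diff_right f)"
  proof -
    have "exp_growth (\<lambda>n. f n + (-1) * f (n + 1))"
      by (intro exp_growth_add exp_growth_cmult exp_growth_shift assms)
    then show ?thesis by (simp add: diff_right_def[abs_def])
  qed
  have "heat_semigroup t (lap f) n = - heat_semigroup t (diff_left (diff_right f)) n"
    by (simp add: heat_semigroup_eq_conv lap conv_def)
  also have "heat_semigroup t (diff_left (diff_right f)) =
      conv (diff_left (conv ?p ?q)) (diff_right f)"
    using conv_diff_left[OF right geo_norm_heat_kernel_finite[OF assms(1)]] assms
    by (simp add: heat_semigroup_eq_conv heat_kernel_eq_conv)
  also have "\<dots> = conv (conv ?p ?q) (diff_left (diff_right f))"
    using conv_diff_left[OF right geo_norm_heat_kernel_finite[OF assms(1)]] assms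
    by (simp add: heat_kernel_eq_conv)
  also have "\<dots> = conv ?p (conv ?q (diff_left (diff_right f)))"
    by (intro conv_assoc exp_growth_diff_left right fin)
  also have "\<dots> = conv ?p (diff_left (conv ?q (diff_right f)))"
  proof -
    have "conv (diff_left ?q) (diff_right f) = diff_left (conv ?q (diff_right f))"
    proof
      fix n
      have "integrable counting (\<lambda>j. ?q (n - j) * diff_right f j)"
        "integrable counting (\<lambda>j. ?q (n - 1 - j) * diff_right f j)"
        using integrable_conv[OF right fin(2)] by auto
      then show "conv (diff_left ?q) (diff_right f) n = diff_left (conv ?q (diff_right f)) n"
        by (simp add: conv_def diff_left_def left_diff_distrib algebra_simps)
    qed
    then show ?thesis using conv_diff_left[OF right fin(2)] by simp
  qed
  also have "\<dots> = conv (diff_left ?p) (conv ?q (diff_right f))"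
    by (intro conv_diff_left exp_growth_conv right fin)
  also have "\<dots> = conv (diff_left ?p) (conv (diff_right ?q) f)"
    using conv_diff_right[OF assms(2) fin(2)] by simp
  finally show ?thesis .
qed

text \<open>
  \<open>k!\<close> times this number is the \<open>k\<close>-th power of \<open>f \<mapsto> f(\<cdot> + 1) + f(\<cdot> - 1)\<close>, applied to \<open>f\<close> and evaluated at \<open>n\<close>: a
  sum over simple random walk paths with \<open>i\<close> steps to the left and \<open>k - i\<close> to the right.
\<close>

definition walk_coeff :: "(int \<Rightarrow> real) \<Rightarrow> int \<Rightarrow> nat \<Rightarrow> real" where
  "walk_coeff f n k = (\<Sum>i\<le>k. f (n - int i + int (k - i)) / (fact i * fact (k - i)))"

lemma conv_pois_infsum:
  "conv (pois t) g n = (\<Sum>\<^sub>\<infinity>m. pois t (int m) * g (n - int m))"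
proof -
  have "conv (pois t) g n = (\<integral>j. pois t j * g (n - j) \<partial>counting)"
    using integral_reflect[of "\<lambda>j. pois t (n - j) * g j" n] by (simp add: conv_def)
  also have "\<dots> = (\<integral>m. pois t (int m) * g (n - int m) \<partial>count_space UNIV)"
    by (rule integral_counting_nat) (simp add: pois_neg)
  finally show ?thesis by (simp only: infsum_eq_integral_counting)
qed

lemma conv_pois_refl_infsum:
  "conv (pois_refl t) g n = (\<Sum>\<^sub>\<infinity>m. pois t (int m) * g (n + int m))"
proof -
  have "conv (pois_refl t) g n = (\<integral>j. pois t j * g (j + n) \<partial>counting)"
    using integral_shift[of "\<lambda>j. pois_refl t (n - j) * g j" n] by (simp add: conv_def)
  also have "\<dots> = (\<integral>m. pois t (int m) * g (int m + n) \<partial>count_space UNIV)"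
    by (rule integral_counting_nat) (simp add: pois_neg)
  finally show ?thesis by (simp only: infsum_eq_integral_counting add.commute)
qed

text \<open>
  The double sum over both Poisson variables, collected by their sum \<open>k\<close>. It exhibits
  \<open>exp (2 t) * heat_semigroup t f n\<close> as an entire power series in \<open>t\<close>, so that time derivatives can be taken
  termwise.
\<close>

lemma heat_power_series:
  assumes "t > 0" "exp_growth f"
  shows "(\<lambda>k. walk_coeff f n k * t ^ k) sums (exp (2 * t) * heat_semigroup t f n)"
proof -
  obtain C where C: "C \<ge> 0" "\<And>n. \<bar>f n\<bar> \<le> C * geo_weight n"
    using assms(2) by (meson exp_growthE)
  let ?a = "\<lambda>m. t ^ m / fact m" and ?b = "\<lambda>m. (5 / 4 * t) ^ m / fact m"
  let ?F = "\<lambda>(m, l). ?a m * (?a l * f (n - int m + int l))"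
  have bm: "?b m = ?a m * geo_weight (int m)" for m
    by (simp only: geo_weight_def power_mult_distrib) simp
  have b: "Infinite_Sum.abs_summable_on ?b UNIV"
  proof -
    have "summable (\<lambda>m. norm (?b m))"
      using summable_norm_exp[of "5 / 4 * t"] 
      by (simp only: real_scaleR_def divide_inverse mult.commute)
    then have "?b summable_on UNIV" by (rule norm_summable_imp_summable_on)
    then show ?thesis by (rule summable_on_iff_abs_summable_on_real[THEN iffD1])
  qed
  have "Infinite_Sum.abs_summable_on (\<lambda>(m, l). ?b m * ?b l) (UNIV \<times> UNIV)"
    using b unfolding abs_summable_equivalent by (intro abs_summable_on_product) auto
  then have "(\<lambda>x. norm (C * geo_weight n * (case x of (m, l) \<Rightarrow> ?b m * ?b l))) summable_on (UNIV \<times> UNIV)"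
    unfolding norm_mult by (rule summable_on_cmult_right)
  then have F: "Infinite_Sum.abs_summable_on ?F (UNIV \<times> UNIV)"
  proof (rule Infinite_Sum.abs_summable_on_comparison_test)
    fix x :: "nat \<times> nat"
    obtain m l where x: "x = (m, l)" by fastforce
    have "geo_weight (n - int m + int l) \<le> geo_weight (n - int m) * geo_weight (int l)"
      by (rule geo_weight_add_le)
    also have "\<dots> \<le> (geo_weight n * geo_weight (int m)) * geo_weight (int l)"
      using geo_weight_add_le[of n "- int m"] geo_weight_pos[of "int l"] by (intro mult_right_mono) auto
    finally have "\<bar>f (n - int m + int l)\<bar> \<le> C * (geo_weight n * geo_weight (int m) * geo_weight (int l))"
      using C by (meson mult_left_mono order_trans)
    then have "?a m * (?a l * \<bar>f (n - int m + int l)\<bar>) \<le>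
       ?a m * (?a l * (C * (geo_weight n * geo_weight (int m) * geo_weight (int l))))"
      using assms(1) by (intro mult_left_mono) auto
    also have "\<dots> = C * geo_weight n * (?b m * ?b l)"
      unfolding bm by (simp only: mult_ac)
    finally show "norm (?F x) \<le> norm (C * geo_weight n * (case x of (m, l) \<Rightarrow> ?b m * ?b l))"
      using assms(1) C(1) geo_weight_pos[of n] by (simp add: x abs_mult)
  qed
  have sum: "?F summable_on (UNIV \<times> UNIV)"
    using F by (rule Infinite_Sum.abs_summable_summable)
  have "heat_semigroup t f n = (\<Sum>\<^sub>\<infinity>m. exp (- t) * ?a m * (\<Sum>\<^sub>\<infinity>l. exp (- t) * ?a l * f (n - int m + int l)))"
    using assms by (simp add: heat_semigroup_eq_pois conv_pois_infsum conv_pois_refl_infsum)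
  also have "\<dots> = exp (- t) * exp (- t) * (\<Sum>\<^sub>\<infinity>m. \<Sum>\<^sub>\<infinity>l. ?F (m, l))"
    by (simp add: infsum_cmult_right'[symmetric] mult_ac)
  also have "(\<Sum>\<^sub>\<infinity>m. \<Sum>\<^sub>\<infinity>l. ?F (m, l)) = infsum ?F (UNIV \<times> UNIV)"
    using infsum_Sigma'_banach[of "\<lambda>m l. ?F (m, l)" UNIV "\<lambda>_. UNIV"] sum by simp
  finally have "exp (2 * t) * heat_semigroup t f n = infsum ?F (UNIV \<times> UNIV)"
    by (simp add: exp_minus field_simps mult_exp_exp)
  then have hs: "(?F has_sum (exp (2 * t) * heat_semigroup t f n)) (UNIV \<times> UNIV)"
    using sum by (simp add: has_sum_infsum)
  have "((\<lambda>(k, i). ?F (i, k - i)) has_sum (exp (2 * t) * heat_semigroup t f n)) (Sigma UNIV (\<lambda>k. {..k}))"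
    using hs by (subst has_sum_reindex_bij_witness[of "Sigma UNIV (\<lambda>k. {..k})" "\<lambda>(m, l). (m + l, m)"
      "\<lambda>(k, i). (i, k - i)" "UNIV \<times> UNIV" ?F]) auto
  then have "((\<lambda>k. walk_coeff f n k * t ^ k) has_sum (exp (2 * t) * heat_semigroup t f n)) UNIV"
  proof (rule has_sum_SigmaD)
    fix k
    have "(\<Sum>i\<le>k. ?F (i, k - i)) = walk_coeff f n k * t ^ k"
      unfolding walk_coeff_def sum_distrib_right
    proof (intro sum.cong refl)
      fix i assume "i \<in> {..k}"
      then have "t ^ k = t ^ i * t ^ (k - i)" by (simp add: power_add[symmetric])
      then show "?F (i, k - i) = f (n - int i + int (k - i)) / (fact i * fact (k - i)) * t ^ k"
        by simp
    qed
    then show "((\<lambda>i. case (k, i) of (k, i) \<Rightarrow> ?F (i, k - i)) has_sum walk_coeff f n k * t ^ k) {..k}"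
      using has_sum_finite[of "{..k}" "\<lambda>i. ?F (i, k - i)"] by simp
  qed
  then show ?thesis by (rule has_sum_imp_sums)
qed

text \<open>
  Pascal's rule: in \<open>k + 1 = i + (k + 1 - i)\<close>, the first summand cancels a left step and the second one a right
  step.
\<close>

lemma diffs_walk_coeff:
  "diffs (walk_coeff f n) k = walk_coeff (lap f) n k + 2 * walk_coeff f n k"
proof -
  have cancel: "real (Suc i) * (x / (fact (Suc i) * y)) = x / (fact i * y)"
    "real (Suc i) * (x / (y * fact (Suc i))) = x / (y * fact i)" for i and x y :: real
    by (simp_all add: divide_simps del: of_nat_Suc)
  let ?G = "\<lambda>i. f (n - int i + int (Suc k - i)) / (fact i * fact (Suc k - i))"
  have "diffs (walk_coeff f n) k = (\<Sum>i\<le>Suc k. (real i + real (Suc k - i)) * ?G i)"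
    unfolding diffs_def walk_coeff_def sum_distrib_left by (intro sum.cong) auto
  also have "\<dots> = (\<Sum>i\<le>Suc k. real i * ?G i) + (\<Sum>i\<le>Suc k. real (Suc k - i) * ?G i)"
    by (simp only: distrib_right sum.distrib)
  also have "(\<Sum>i\<le>Suc k. real i * ?G i) = (\<Sum>i\<le>k. f (n - int i + int (k - i) - 1) / (fact i * fact (k - i)))"
  proof -
    have "(\<Sum>i\<le>Suc k. real i * ?G i) = (\<Sum>i\<le>k. real (Suc i) * ?G (Suc i))"
      by (subst sum.atMost_Suc_shift) simp
    also have "\<dots> = (\<Sum>i\<le>k. f (n - int i + int (k - i) - 1) / (fact i * fact (k - i)))"
      by (intro sum.cong refl) (simp only: diff_Suc_Suc cancel, simp add: algebra_simps)
    finally show ?thesis .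
  qed
  also have "(\<Sum>i\<le>Suc k. real (Suc k - i) * ?G i) = (\<Sum>i\<le>k. f (n - int i + int (k - i) + 1) / (fact i * fact (k - i)))"
  proof -
    have "(\<Sum>i\<le>Suc k. real (Suc k - i) * ?G i) = (\<Sum>i\<le>k. real (Suc k - i) * ?G i)"
      by (subst sum.atMost_Suc) simp
    also have "\<dots> = (\<Sum>i\<le>k. f (n - int i + int (k - i) + 1) / (fact i * fact (k - i)))"
      by (intro sum.cong refl) (simp only: Suc_diff_le atMost_iff cancel, simp add: algebra_simps)
    finally show ?thesis .
  qed
  also have "(\<Sum>i\<le>k. f (n - int i + int (k - i) - 1) / (fact i * fact (k - i)))
      + (\<Sum>i\<le>k. f (n - int i + int (k - i) + 1) / (fact i * fact (k - i)))
      = walk_coeff (lap f) n k + 2 * walk_coeff f n k"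
    by (simp add: walk_coeff_def lap_def sum_distrib_left sum.distrib[symmetric] add_divide_distrib diff_divide_distrib add.commute)
  finally show ?thesis .
qed

text \<open>
  The heat equation. The coefficients of the differentiated series are those of \<open>lap f\<close> plus twice those of
  \<open>f\<close>, and the factor \<open>exp (- 2 t)\<close> removes the latter.
\<close>

lemma heat_has_derivative:
  assumes "t > 0" "exp_growth f"
  shows "((\<lambda>s. heat_semigroup s f n) has_real_derivative heat_semigroup t (lap f) n) (at t)"
proof -
  let ?c = "walk_coeff f n"
  have "summable (\<lambda>k. ?c k * y ^ k)" for y
  proof -
    have "summable (\<lambda>k. ?c k * (\<bar>y\<bar> + 1) ^ k)"
      using heat_power_series[of "\<bar>y\<bar> + 1" f n] assms(2) by (auto simp: sums_iff)
    then show ?thesis by (rule powser_inside) simp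
  qed
  then have D: "((\<lambda>x. \<Sum>k. ?c k * x ^ k) has_real_derivative (\<Sum>k. diffs ?c k * t ^ k)) (at t)"
    by (rule termdiffs_strong_converges_everywhere)
  have "(\<lambda>k. walk_coeff (lap f) n k * t ^ k + 2 * (?c k * t ^ k)) sums
      (exp (2 * t) * heat_semigroup t (lap f) n + 2 * (exp (2 * t) * heat_semigroup t f n))"
    by (intro sums_add sums_mult heat_power_series exp_growth_lap assms)
  then have diffs: "(\<Sum>k. diffs ?c k * t ^ k) =
      exp (2 * t) * heat_semigroup t (lap f) n + 2 * (exp (2 * t) * heat_semigroup t f n)"
    by (simp add: diffs_walk_coeff algebra_simps sums_iff)
  have val: "heat_semigroup s f n = exp (- 2 * s) * (\<Sum>k. ?c k * s ^ k)" if "s > 0" for s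
    using heat_power_series[OF that assms(2), of n] by (simp add: sums_iff exp_minus)
  have "((\<lambda>s. exp (- 2 * s) * (\<Sum>k. ?c k * s ^ k)) has_real_derivative
      (exp (- 2 * t) * (- 2) * (\<Sum>k. ?c k * t ^ k) + (\<Sum>k. diffs ?c k * t ^ k) * exp (- 2 * t))) (at t)"
    by (rule DERIV_mult D | auto intro!: derivative_eq_intros)+
  also have "exp (- 2 * t) * (- 2) * (\<Sum>k. ?c k * t ^ k) + (\<Sum>k. diffs ?c k * t ^ k) * exp (- 2 * t) =
      heat_semigroup t (lap f) n"
    unfolding diffs using val[OF assms(1)] by (simp add: algebra_simps exp_minus)
  finally show ?thesis
    by (rule has_field_derivative_transform_within_open[of _ _ _ "{0<..}"]) (use assms val in auto)
qed

lemma higher_deriv_heat: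
  assumes "exp_growth f" "t > 0"
  shows "(deriv ^^ k) (\<lambda>s. heat_semigroup s f n) t = heat_semigroup t ((lap ^^ k) f) n"
  using assms(2)
proof (induction k arbitrary: t)
  case (Suc k)
  have "eventually (\<lambda>s. s \<in> {0<..}) (nhds t)"
    using Suc.prems by (intro eventually_nhds_in_open) auto
  then have "eventually (\<lambda>s. (deriv ^^ k) (\<lambda>s. heat_semigroup s f n) s = heat_semigroup s ((lap ^^ k) f) n) (nhds t)"
    by eventually_elim (simp add: Suc.IH)
  then have "deriv ((deriv ^^ k) (\<lambda>s. heat_semigroup s f n)) t = deriv (\<lambda>s. heat_semigroup s ((lap ^^ k) f) n) t"
    by (rule deriv_cong_ev) simp
  also have "\<dots> = heat_semigroup t (lap ((lap ^^ k) f)) n"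
    by (intro DERIV_imp_deriv heat_has_derivative exp_growth_lap_power assms Suc.prems)
  finally show ?case by simp
qed simp

lemma continuous_on_heat:
  assumes "exp_growth f"
  shows "continuous_on {0<..} (\<lambda>t. heat_semigroup t f n)"
  using heat_has_derivative[OF _ assms] by (intro DERIV_continuous_on) (auto intro: has_field_derivative_at_within)

section \<open>Minkowski and Young inequalities for sequence norms\<close>

lemma ennpowr_ennreal: "x \<ge> 0 \<Longrightarrow> ennpowr (ennreal x) r = ennreal (x powr r)"
  by (simp add: ennpowr_def)

lemma ennpowr_0 [simp]: "ennpowr 0 r = 0"
  by (simp add: ennpowr_def)

lemma ennpowr_top [simp]: "ennpowr \<infinity> r = \<infinity>" "ennpowr top r = top"
  by (simp_all add: ennpowr_def)

lemma ennpowr_less_top_iff: "ennpowr x r < \<infinity> \<longleftrightarrow> x < \<infinity>"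
  by (cases x) (auto simp: ennpowr_def)

lemma ennpowr_mono: "x \<le> y \<Longrightarrow> r \<ge> 0 \<Longrightarrow> ennpowr x r \<le> ennpowr y r"
  by (cases x; cases y) (auto simp: ennpowr_ennreal top_unique intro!: ennreal_leI powr_mono2)

lemma ennpowr_mult: "r > 0 \<Longrightarrow> ennpowr (x * y) r = ennpowr x r * ennpowr y r"
  by (cases x; cases y)
    (auto simp: ennpowr_ennreal ennreal_mult[symmetric] powr_mult ennreal_mult_top ennreal_top_mult zero_less_iff_neq_zero)

lemma ennpowr_ennpowr: "r > 0 \<Longrightarrow> s > 0 \<Longrightarrow> ennpowr (ennpowr x r) s = ennpowr x (r * s)"
  by (cases x) (auto simp: ennpowr_ennreal powr_powr)

lemma ennpowr_1 [simp]: "ennpowr x 1 = x"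
  by (cases x) (auto simp: ennpowr_ennreal)

lemma measurable_ennpowr [measurable (raw)]:
  "f \<in> borel_measurable M \<Longrightarrow> (\<lambda>x. ennpowr (f x) r) \<in> borel_measurable M"
proof -
  assume [measurable]: "f \<in> borel_measurable M"
  have "{x \<in> space M. f x = \<infinity>} = f -` {\<infinity>} \<inter> space M" by auto
  also have "\<dots> \<in> sets M" by measurable
  finally have "Measurable.pred M (\<lambda>x. f x = \<infinity>)" by (simp add: pred_def)
  moreover have "(\<lambda>x. ennreal (enn2real (f x) powr r)) \<in> borel_measurable M"
    by measurable
  ultimately show ?thesis
    unfolding ennpowr_def by (intro measurable_If) (auto simp: pred_def)
qed

lemma tangent_powr_le:
  fixes a h p :: real
  assumes "p \<ge> 1" "a > 0" "h \<ge> 0"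
  shows "p * a powr (p - 1) * h \<le> h powr p + (p - 1) * a powr p"
proof (cases "h = 0")
  case False
  then have h: "h > 0" using assms by simp
  have "h powr p - a powr p \<ge> p * a powr (p - 1) * (h - a)"
  proof (rule convex_on_imp_above_tangent[of "{0<..}"])
    show "convex_on {0<..} (\<lambda>x. x powr p)"
      using assms(1) by (rule powr_convex)
    show "((\<lambda>x. x powr p) has_real_derivative p * a powr (p - 1)) (at a within {0<..})"
      by (rule has_field_derivative_at_within[OF has_real_derivative_powr[OF assms(2)]])
  qed (use assms h in \<open>auto simp: interior_open connected_Ioi\<close>)
  moreover have "p * a powr (p - 1) * (h - a) = p * a powr (p - 1) * h - p * (a powr (p - 1) * a)"
    by (simp only: right_diff_distrib mult.assoc)
  moreover have "a powr (p - 1) * a = a powr p"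
    using assms(2) powr_add[of a "p - 1" 1] by simp
  ultimately show ?thesis by (simp add: left_diff_distrib)
qed (use assms in simp)

text \<open>
  Jensen's inequality for the convex function \<open>x powr p\<close> and a measure of total mass at most one. The tangent at
  \<open>a\<close> is integrated against \<open>w\<close>; the choice of \<open>a\<close> as the mean gives the claim when the mean is finite, and
  \<open>a = 1\<close> shows that an infinite mean forces an infinite right-hand side.
\<close>

lemma powr_nn_integral_le:
  assumes [measurable]: "w \<in> borel_measurable N" "h \<in> borel_measurable N"
    and w: "(\<integral>\<^sup>+x. w x \<partial>N) \<le> 1" and p: "p \<ge> 1"
  shows "ennpowr (\<integral>\<^sup>+x. w x * h x \<partial>N) p \<le> (\<integral>\<^sup>+x. w x * ennpowr (h x) p \<partial>N)"
proof -
  let ?I = "\<integral>\<^sup>+x. w x * h x \<partial>N" and ?J = "\<integral>\<^sup>+x. w x * ennpowr (h x) p \<partial>N"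
  have tangent: "ennreal (p * a powr (p - 1)) * ?I \<le> ?J + ennreal ((p - 1) * a powr p)" if a: "a > 0" for a
  proof -
    have pw: "ennreal (p * a powr (p - 1)) * y \<le> ennpowr y p + ennreal ((p - 1) * a powr p)" for y
    proof (cases y)
      case (real r)
      then show ?thesis
        using tangent_powr_le[OF p a, of r] p
        by (simp add: ennpowr_ennreal ennreal_mult[symmetric] ennreal_plus[symmetric] del: ennreal_plus)
    qed simp
    have "ennreal (p * a powr (p - 1)) * ?I = (\<integral>\<^sup>+x. w x * (ennreal (p * a powr (p - 1)) * h x) \<partial>N)"
      by (simp add: nn_integral_cmult[symmetric] mult_ac)
    also have "\<dots> \<le> (\<integral>\<^sup>+x. w x * (ennpowr (h x) p + ennreal ((p - 1) * a powr p)) \<partial>N)"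
      by (intro nn_integral_mono mult_left_mono pw) auto
    also have "\<dots> = ?J + (\<integral>\<^sup>+x. w x \<partial>N) * ennreal ((p - 1) * a powr p)"
      by (simp add: distrib_left nn_integral_add nn_integral_multc)
    also have "\<dots> \<le> ?J + 1 * ennreal ((p - 1) * a powr p)"
      by (intro add_left_mono mult_right_mono w) auto
    finally show ?thesis by simp
  qed
  show ?thesis
  proof (cases ?I)
    case top
    then have "?J + ennreal (p - 1) = top"
      using tangent[of 1] p by (simp add: ennreal_mult_top top_unique)
    then show ?thesis by simp
  next
    case (real r)
    show ?thesis
    proof (cases ?J)
      case J: (real j)
      show ?thesis
      proof (cases "r = 0")
        case False
        then have r: "r > 0" using real by simp
        have "p * r powr (p - 1) * r \<le> j + (p - 1) * r powr p"
          using tangent[OF r] real J p r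
          by (simp add: ennreal_mult[symmetric] ennreal_plus[symmetric] del: ennreal_plus)
        moreover have "r powr (p - 1) * r = r powr p"
          using r powr_add[of r "p - 1" 1] by simp
        ultimately have "r powr p \<le> j"
          by (simp add: mult.assoc left_diff_distrib)
        then show ?thesis using real J by (simp add: ennpowr_ennreal)
      qed (use real in simp)
    qed simp
  qed
qed

lemma lp_norm_finite_exponent:
  assumes "p \<noteq> \<infinity>" "p \<ge> 1"
  shows "lp_norm p g = ennpowr (\<integral>\<^sup>+n. ennpowr (ennreal \<bar>g n\<bar>) (enn2real p) \<partial>counting) (1 / enn2real p)"
  using assms by (simp add: lp_norm_def ennpowr_ennreal)

lemma enn2real_ge_1: "p \<noteq> \<infinity> \<Longrightarrow> 1 \<le> p \<Longrightarrow> 1 \<le> enn2real p"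
  by (cases p) auto

lemma abs_le_lp_norm:
  assumes "p \<ge> 1"
  shows "ennreal \<bar>g n\<bar> \<le> lp_norm p g"
proof (cases "p = \<infinity>")
  case True
  then show ?thesis by (auto simp: lp_norm_def intro: SUP_upper)
next
  case False
  let ?r = "enn2real p"
  have r: "?r \<ge> 1" using enn2real_ge_1[OF False assms] .
  have "ennpowr (ennreal \<bar>g n\<bar>) ?r \<le> (\<integral>\<^sup>+n. ennpowr (ennreal \<bar>g n\<bar>) ?r \<partial>counting)"
    by (rule nn_integral_ge_point) simp
  then have "ennpowr (ennpowr (ennreal \<bar>g n\<bar>) ?r) (1 / ?r) \<le> lp_norm p g"
    unfolding lp_norm_finite_exponent[OF False assms] using r by (intro ennpowr_mono) auto
  then show ?thesis using r by (simp add: ennpowr_ennpowr)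
qed

lemma lp_norm_mono:
  assumes "\<And>n. \<bar>g n\<bar> \<le> \<bar>h n\<bar>" "p \<ge> 1"
  shows "lp_norm p g \<le> lp_norm p h"
proof (cases "p = \<infinity>")
  case True
  then show ?thesis using assms(1) by (auto simp: lp_norm_def intro!: SUP_mono ennreal_leI)
next
  case False
  then show ?thesis
    unfolding lp_norm_finite_exponent[OF False assms(2)]
    using assms(1) enn2real_ge_1[OF False assms(2)]
    by (intro ennpowr_mono nn_integral_mono ennreal_leI) auto
qed

lemma lp_norm_cmult:
  assumes "p \<ge> 1"
  shows "lp_norm p (\<lambda>n. c * g n) = ennreal \<bar>c\<bar> * lp_norm p g"
proof (cases "p = \<infinity>")
  case True
  then show ?thesis by (simp add: lp_norm_def abs_mult ennreal_mult SUP_mult_left_ennreal)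
next
  case False
  then show ?thesis
    unfolding lp_norm_finite_exponent[OF False assms]
    using enn2real_ge_1[OF False assms]
    by (simp add: abs_mult ennreal_mult ennpowr_mult nn_integral_cmult ennpowr_ennpowr)
qed

lemma lp_norm_reindex:
  assumes "bij \<pi>"
  shows "lp_norm p (\<lambda>n. g (\<pi> n)) = lp_norm p g"
proof -
  have "range (\<lambda>n. ennreal \<bar>g (\<pi> n)\<bar>) = range (\<lambda>n. ennreal \<bar>g n\<bar>)"
    using image_image[of "\<lambda>n. ennreal \<bar>g n\<bar>" \<pi> UNIV] bij_is_surj[OF assms] by simp
  then show ?thesis
    unfolding lp_norm_def
    using nn_integral_bij_count_space[OF assms, of "\<lambda>n. ennreal (\<bar>g n\<bar> powr enn2real p)"]
    by simp
qed

lemma measurable_lp_norm: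
  assumes [measurable]: "\<And>n. (\<lambda>t. F t n) \<in> borel_measurable M"
  shows "(\<lambda>t. lp_norm p (F t)) \<in> borel_measurable M"
proof (cases "p = \<infinity>")
  case False
  have "(\<lambda>(t, n). ennreal (\<bar>F t n\<bar> powr enn2real p)) \<in> borel_measurable (M \<Otimes>\<^sub>M counting)"
    unfolding split_beta
    by (rule measurable_compose_countable'[where g=snd and I=UNIV]) measurable
  then have [measurable]: "(\<lambda>t. \<integral>\<^sup>+n. ennreal (\<bar>F t n\<bar> powr enn2real p) \<partial>counting) \<in> borel_measurable M"
    using sigma_finite_measure.borel_measurable_nn_integral[OF sigma_finite_counting] by simp
  show ?thesis using False by (simp add: lp_norm_def)
qed (simp add: lp_norm_def)

text \<open>
  Minkowski's integral inequality. Divided by \<open>S\<close>, the integral of the norms \<open>N t\<close>, these norms are the density of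
  a probability measure; Jensen's inequality for it, applied to \<open>\<bar>F t n\<bar> * S / N t\<close> and summed over \<open>n\<close>, leaves
  exactly \<open>S\<close>, because each normalised \<open>F t / N t\<close> has norm one.
\<close>

lemma lp_norm_le_nn_integral:
  assumes p: "p \<ge> 1" and [measurable]: "\<And>n. (\<lambda>t. F t n) \<in> borel_measurable M"
    and le: "\<And>n. ennreal \<bar>g n\<bar> \<le> (\<integral>\<^sup>+t. ennreal \<bar>F t n\<bar> \<partial>M)"
  shows "lp_norm p g \<le> (\<integral>\<^sup>+t. lp_norm p (F t) \<partial>M)"
proof (cases "p = \<infinity>")
  case True
  have "ennreal \<bar>g n\<bar> \<le> (\<integral>\<^sup>+t. lp_norm p (F t) \<partial>M)" for n
    by (rule order_trans[OF le]) (intro nn_integral_mono abs_le_lp_norm p)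
  then show ?thesis using True by (auto simp: lp_norm_def intro!: SUP_least)
next
  case False
  let ?r = "enn2real p" and ?N = "\<lambda>t. lp_norm p (F t)"
  have [measurable]: "?N \<in> borel_measurable M"
    by (rule measurable_lp_norm) measurable
  have r: "?r \<ge> 1" using enn2real_ge_1[OF False p] .
  have N: "ennpowr (?N t) ?r = (\<integral>\<^sup>+n. ennpowr (ennreal \<bar>F t n\<bar>) ?r \<partial>counting)" for t
    unfolding lp_norm_finite_exponent[OF False p] using r by (simp add: ennpowr_ennpowr)
  define S where "S = (\<integral>\<^sup>+t. ?N t \<partial>M)"
  have F_le: "ennreal \<bar>F t n\<bar> \<le> ?N t" for t n
    by (rule abs_le_lp_norm[OF p])
  consider "S = 0" | "S = \<infinity>" | "0 < S" "S < \<infinity>"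
    by (metis infinity_ennreal_def less_top not_gr_zero)
  then show ?thesis
  proof cases
    case 1
    have "ennreal \<bar>g n\<bar> \<le> S" for n
      unfolding S_def by (rule order_trans[OF le]) (intro nn_integral_mono F_le)
    then have "g n = 0" for n using 1 by simp
    then show ?thesis
      unfolding lp_norm_finite_exponent[OF False p] by simp
  next
    case 3
    have fin: "AE t in M. ?N t \<noteq> \<infinity>"
      using 3(2) unfolding S_def by (intro nn_integral_noteq_infinite) auto
    have unit: "(\<integral>\<^sup>+t. ?N t / S \<partial>M) \<le> 1"
      using 3 by (simp add: nn_integral_divide S_def[symmetric])
    have pw: "ennpowr (ennreal \<bar>g n\<bar>) ?r \<le> (\<integral>\<^sup>+t. ?N t / S * ennpowr (ennreal \<bar>F t n\<bar> * (S / ?N t)) ?r \<partial>M)" for n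
    proof -
      have "ennreal \<bar>g n\<bar> \<le> (\<integral>\<^sup>+t. ?N t / S * (ennreal \<bar>F t n\<bar> * (S / ?N t)) \<partial>M)"
      proof (rule order_trans[OF le nn_integral_mono_AE])
        show "AE t in M. ennreal \<bar>F t n\<bar> \<le> ?N t / S * (ennreal \<bar>F t n\<bar> * (S / ?N t))"
          using fin
        proof eventually_elim
          case (elim t)
          show ?case
          proof (cases "?N t = 0")
            case False
            then have "?N t / S * (S / ?N t) = 1"
              using 3 elim
              by (cases "?N t"; cases S) (auto simp: divide_ennreal ennreal_mult[symmetric] zero_less_iff_neq_zero)
            then have "?N t / S * (ennreal \<bar>F t n\<bar> * (S / ?N t)) = ennreal \<bar>F t n\<bar>"
              by (metis mult.left_commute mult.right_neutral)
            then show ?thesis by simp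
          qed (use F_le[of t n] in simp)
        qed
      qed
      then have "ennpowr (ennreal \<bar>g n\<bar>) ?r \<le> ennpowr (\<integral>\<^sup>+t. ?N t / S * (ennreal \<bar>F t n\<bar> * (S / ?N t)) \<partial>M) ?r"
        using r by (intro ennpowr_mono) auto
      also have "\<dots> \<le> (\<integral>\<^sup>+t. ?N t / S * ennpowr (ennreal \<bar>F t n\<bar> * (S / ?N t)) ?r \<partial>M)"
        by (intro powr_nn_integral_le unit r) measurable
      finally show ?thesis .
    qed
    have "(\<integral>\<^sup>+n. ennpowr (ennreal \<bar>g n\<bar>) ?r \<partial>counting) \<le>
        (\<integral>\<^sup>+n. \<integral>\<^sup>+t. ?N t / S * ennpowr (ennreal \<bar>F t n\<bar> * (S / ?N t)) ?r \<partial>M \<partial>counting)"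
      by (intro nn_integral_mono pw)
    also have "\<dots> = (\<integral>\<^sup>+t. \<integral>\<^sup>+n. ?N t / S * ennpowr (ennreal \<bar>F t n\<bar> * (S / ?N t)) ?r \<partial>counting \<partial>M)"
      by (rule nn_integral_count_space_nn_integral[symmetric]) auto
    also have "\<dots> = (\<integral>\<^sup>+t. ?N t / S * (ennpowr (?N t * (S / ?N t)) ?r) \<partial>M)"
      using r by (simp add: ennpowr_mult N nn_integral_cmult nn_integral_multc)
    also have "\<dots> \<le> (\<integral>\<^sup>+t. ?N t / S * ennpowr S ?r \<partial>M)"
    proof (rule nn_integral_mono_AE)
      show "AE t in M. ?N t / S * ennpowr (?N t * (S / ?N t)) ?r \<le> ?N t / S * ennpowr S ?r"
        using fin
      proof eventually_elim
        case (elim t)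
        have "?N t * (S / ?N t) \<le> S"
          using 3 elim
          by (cases "?N t"; cases S; cases "?N t = 0") (auto simp: divide_ennreal ennreal_mult[symmetric] zero_less_iff_neq_zero)
        then show ?case using r by (intro mult_left_mono ennpowr_mono) auto
      qed
    qed
    also have "\<dots> = (\<integral>\<^sup>+t. ?N t / S \<partial>M) * ennpowr S ?r"
      by (rule nn_integral_multc) measurable
    also have "\<dots> \<le> 1 * ennpowr S ?r"
      by (intro mult_right_mono unit) simp
    finally have "ennpowr (\<integral>\<^sup>+n. ennpowr (ennreal \<bar>g n\<bar>) ?r \<partial>counting) (1 / ?r) \<le> ennpowr (ennpowr S ?r) (1 / ?r)"
      using r by (intro ennpowr_mono) auto
    also have "\<dots> = S"
      using r by (simp add: ennpowr_ennpowr)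
    finally show ?thesis
      by (simp only: lp_norm_finite_exponent[OF False p, of g] S_def)
  qed (simp add: S_def)
qed

text \<open>
  Young's inequality, as Minkowski's inequality for a superposition of translates of \<open>f\<close>.
\<close>

lemma lp_norm_conv_le:
  assumes p: "p \<ge> 1"
  shows "lp_norm p (conv a f) \<le> (\<integral>\<^sup>+m. ennreal \<bar>a m\<bar> \<partial>counting) * lp_norm p f"
proof -
  have "lp_norm p (conv a f) \<le> (\<integral>\<^sup>+m. lp_norm p (\<lambda>n. a m * f (n - m)) \<partial>counting)"
  proof (rule lp_norm_le_nn_integral[OF p])
    fix n
    have "ennreal \<bar>conv a f n\<bar> \<le> (\<integral>\<^sup>+j. ennreal \<bar>a (n - j) * f j\<bar> \<partial>counting)"
      by (rule abs_conv_le_nn_integral)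
    then show "ennreal \<bar>conv a f n\<bar> \<le> (\<integral>\<^sup>+m. ennreal \<bar>a m * f (n - m)\<bar> \<partial>counting)"
      using nn_integral_reflect[of "\<lambda>j. ennreal \<bar>a (n - j) * f j\<bar>" n] by simp
  qed simp
  also have "\<dots> = (\<integral>\<^sup>+m. ennreal \<bar>a m\<bar> * lp_norm p f \<partial>counting)"
  proof (intro nn_integral_cong)
    fix m
    have "bij (\<lambda>n::int. n - m)"
      by (rule bij_betw_byWitness[where f'="\<lambda>n. n + m"]) auto
    then show "lp_norm p (\<lambda>n. a m * f (n - m)) = ennreal \<bar>a m\<bar> * lp_norm p f"
      using lp_norm_reindex[of "\<lambda>n. n - m" p f] by (simp add: lp_norm_cmult[OF p])
  qed
  also have "\<dots> = (\<integral>\<^sup>+m. ennreal \<bar>a m\<bar> \<partial>counting) * lp_norm p f"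
    by (rule nn_integral_multc) simp
  finally show ?thesis .
qed

section \<open>Smoothing of the heat semigroup and its action on Bessel potentials\<close>

lemma nn_integral_abs_pois:
  assumes "t \<ge> 0"
  shows "(\<integral>\<^sup>+m. ennreal \<bar>pois t m\<bar> \<partial>counting) = 1"
proof -
  have "(\<lambda>m. exp (- t) * (t ^ m /\<^sub>R fact m)) sums (exp (- t) * exp t)"
    by (intro sums_mult exp_converges)
  also have "(\<lambda>m. exp (- t) * (t ^ m /\<^sub>R fact m)) = (\<lambda>m. \<bar>pois t (int m)\<bar>)"
    using assms by (simp add: fun_eq_iff divide_inverse)
  also have "exp (- t) * exp t = 1"
    by (simp add: exp_add[symmetric])
  finally have "(\<Sum>m. ennreal \<bar>pois t (int m)\<bar>) = ennreal 1"
    by (intro suminf_ennreal_eq) auto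
  then show ?thesis
    by (subst nn_integral_counting_nat) (simp_all add: pois_neg)
qed

lemma lp_norm_heat_le:
  assumes "p \<ge> 1" "t > 0" "exp_growth f"
  shows "lp_norm p (heat_semigroup t f) \<le> lp_norm p f"
proof -
  have p: "(\<integral>\<^sup>+m. ennreal \<bar>pois t m\<bar> \<partial>counting) = 1"
    using assms by (intro nn_integral_abs_pois) auto
  have q: "(\<integral>\<^sup>+m. ennreal \<bar>pois_refl t m\<bar> \<partial>counting) = 1"
    using p nn_integral_reflect[of "\<lambda>m. ennreal \<bar>pois t m\<bar>" 0] by simp
  show ?thesis
    unfolding heat_semigroup_eq_pois[OF assms(2,3)]
    using lp_norm_conv_le[OF assms(1), of "pois t" "conv (pois_refl t) f"]
      lp_norm_conv_le[OF assms(1), of "pois_refl t" f] unfolding p q by simp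
qed

text \<open>
  Each of the two differentiated Poisson factors has \<open>\<ell>\<^sup>1\<close> norm at most \<open>t\<^bsup>-1/2\<^esup>\<close>.
\<close>

lemma lp_norm_heat_lap_le:
  assumes "p \<ge> 1" "t > 0" "exp_growth f"
  shows "lp_norm p (heat_semigroup t (lap f)) \<le> ennreal (1 / t) * lp_norm p f"
proof -
  let ?a = "diff_left (pois t)" and ?b = "diff_right (pois_refl t)"
  let ?s = "ennreal (1 / sqrt t)"
  have a: "(\<integral>\<^sup>+m. ennreal \<bar>?a m\<bar> \<partial>counting) \<le> ?s"
    by (rule nn_integral_diff_pois_le[OF assms(2)])
  have "?b = (\<lambda>n. ?a (0 - n))"
    by (simp add: fun_eq_iff diff_left_def diff_right_def)
  then have b: "(\<integral>\<^sup>+m. ennreal \<bar>?b m\<bar> \<partial>counting) \<le> ?s"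
    using a nn_integral_reflect[of "\<lambda>m. ennreal \<bar>?a m\<bar>" 0] by simp
  have "lp_norm p (heat_semigroup t (lap f)) = lp_norm p (\<lambda>n. (-1) * conv ?a (conv ?b f) n)"
    by (intro arg_cong[where f="lp_norm p"] ext) (simp add: heat_lap_eq[OF assms(2,3)])
  also have "\<dots> = lp_norm p (conv ?a (conv ?b f))"
    by (subst lp_norm_cmult[OF assms(1)]) simp
  also have "\<dots> \<le> (\<integral>\<^sup>+m. ennreal \<bar>?a m\<bar> \<partial>counting) * lp_norm p (conv ?b f)"
    by (rule lp_norm_conv_le[OF assms(1)])
  also have "\<dots> \<le> ?s * (?s * lp_norm p f)"
    by (intro mult_mono a order_trans[OF lp_norm_conv_le[OF assms(1)]] b mult_right_mono) auto
  also have "\<dots> = ennreal (1 / t) * lp_norm p f"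
    using assms(2) by (simp add: mult.assoc[symmetric] ennreal_mult[symmetric])
  finally show ?thesis .
qed

lemma heat_halves:
  assumes "t > 0" "exp_growth f"
  shows "heat_semigroup t ((lap ^^ (m + k)) f) =
    heat_semigroup (t / 2) ((lap ^^ m) (heat_semigroup (t / 2) ((lap ^^ k) f)))"
proof -
  have "heat_semigroup t ((lap ^^ (m + k)) f) =
      heat_semigroup (t / 2) (heat_semigroup (t / 2) ((lap ^^ m) ((lap ^^ k) f)))"
    using heat_semigroup_add[of "t / 2" "t / 2" "(lap ^^ (m + k)) f"] assms
    by (simp add: exp_growth_lap_power funpow_add)
  also have "heat_semigroup (t / 2) ((lap ^^ m) ((lap ^^ k) f)) = (lap ^^ m) (heat_semigroup (t / 2) ((lap ^^ k) f))"
    using assms by (intro heat_lap_power exp_growth_lap_power) auto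
  finally show ?thesis .
qed

lemma ennreal_mult_assoc: "x \<ge> 0 \<Longrightarrow> y \<ge> 0 \<Longrightarrow> ennreal (x * y) * z = ennreal x * (ennreal y * z)"
  by (simp add: ennreal_mult mult.assoc)

text \<open>
  The time \<open>t\<close> is halved at every step: one Laplacian is absorbed by \<open>e\<^bsup>(t/2)\<Delta>\<^esup>\<close> at cost \<open>2 / t\<close>, and the remaining ones
  by the other half.
\<close>

lemma lp_norm_heat_lap_power_le:
  assumes p: "p \<ge> 1"
  shows "\<exists>C\<ge>0. \<forall>t>0. \<forall>f. exp_growth f \<longrightarrow>
    lp_norm p (heat_semigroup t ((lap ^^ m) f)) \<le> ennreal (C * t powr (- real m)) * lp_norm p f"
proof (induction m)
  case 0
  show ?case using lp_norm_heat_le[OF p] by (intro exI[of _ 1]) simp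
next
  case (Suc m)
  then obtain C where C: "C \<ge> 0" "\<And>t f. t > 0 \<Longrightarrow> exp_growth f \<Longrightarrow>
      lp_norm p (heat_semigroup t ((lap ^^ m) f)) \<le> ennreal (C * t powr (- real m)) * lp_norm p f"
    by blast
  have "lp_norm p (heat_semigroup t ((lap ^^ Suc m) f)) \<le>
      ennreal (C * 2 powr (real m + 1) * t powr (- real (Suc m))) * lp_norm p f" if t: "t > 0" and f: "exp_growth f" for t f
  proof -
    have "lp_norm p (heat_semigroup t ((lap ^^ Suc m) f)) =
        lp_norm p (heat_semigroup (t / 2) (lap (heat_semigroup (t / 2) ((lap ^^ m) f))))"
      using heat_halves[OF t f, of 1 m] by simp
    also have "\<dots> \<le> ennreal (1 / (t / 2)) * lp_norm p (heat_semigroup (t / 2) ((lap ^^ m) f))"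
      using t f by (intro lp_norm_heat_lap_le p exp_growth_heat exp_growth_lap_power) auto
    also have "\<dots> \<le> ennreal (1 / (t / 2)) * (ennreal (C * (t / 2) powr (- real m)) * lp_norm p f)"
      using t f by (intro mult_left_mono C) auto
    also have "\<dots> = ennreal (1 / (t / 2) * (C * (t / 2) powr (- real m))) * lp_norm p f"
      by (rule ennreal_mult_assoc[symmetric]) (use t C(1) in auto)
    also have "1 / (t / 2) * (C * (t / 2) powr (- real m)) = C * (t / 2) powr (- real (Suc m))"
      using t powr_add[of "t / 2" "- 1" "- real m"] by (simp add: powr_minus_divide algebra_simps)
    also have "(t / 2) powr (- real (Suc m)) = 2 powr (real m + 1) * t powr (- real (Suc m))"
    proof -
      have "1 / 2 powr (- real (Suc m)) = 2 powr (real m + 1)"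
        using powr_minus_divide[of 2 "- real (Suc m)"] by (simp add: add.commute)
      moreover have "(t / 2) powr (- real (Suc m)) = t powr (- real (Suc m)) * (1 / 2 powr (- real (Suc m)))"
        using t by (simp only: powr_divide) simp
      ultimately show ?thesis by (simp only: mult.commute)
    qed
    finally show ?thesis by (simp add: mult.assoc)
  qed
  then show ?case using C(1) by (intro exI[of _ "C * 2 powr (real m + 1)"]) auto
qed

text \<open>
  The density of the Gamma distribution of shape \<open>b\<close>. The Bessel potential of order \<open>\<beta>\<close> is the mean of the heat
  semigroup at a random time with density \<open>gamma_density (\<beta> / 2)\<close>.
\<close>

definition gamma_density :: "real \<Rightarrow> real \<Rightarrow> real" where
  "gamma_density b \<tau> = indicator {0<..} \<tau> * (\<tau> powr (b - 1) * exp (- \<tau>) / Gamma b)"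

lemma gamma_density_nonneg: "b > 0 \<Longrightarrow> gamma_density b \<tau> \<ge> 0"
  by (simp add: gamma_density_def Gamma_real_pos less_imp_le)

lemma measurable_gamma_density [measurable]: "gamma_density b \<in> borel_measurable borel"
  unfolding gamma_density_def[abs_def] by measurable

text \<open>
  The moment that absorbs the growth \<open>exp (\<tau> / 2)\<close> of the heat semigroup on exponentially growing sequences. It is
  reduced to the Gamma integral by the substitution \<open>\<tau> = 2 x\<close>.
\<close>

lemma nn_integral_gamma_density_finite:
  assumes "b > 0"
  shows "(\<integral>\<^sup>+\<tau>. ennreal (gamma_density b \<tau> * exp (\<tau> / 2)) \<partial>lborel) < \<infinity>"
proof -
  let ?g = "\<lambda>t. ennreal (indicator {0..} t * t powr (b - 1) / exp t)"
  have "ennreal (Gamma b) = (\<integral>\<^sup>+t. ?g t \<partial>lborel)"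
    by (rule Gamma_conv_nn_integral_real[OF assms])
  also have "\<dots> = ennreal (1 / 2) * (\<integral>\<^sup>+t. ?g (t / 2) \<partial>lborel)"
    using nn_integral_real_affine[of ?g "1 / 2" 0] by simp
  finally have fin: "(\<integral>\<^sup>+t. ?g (t / 2) \<partial>lborel) < \<infinity>"
    by (auto simp: ennreal_mult_top less_top[symmetric])
  have "(\<integral>\<^sup>+\<tau>. ennreal (gamma_density b \<tau> * exp (\<tau> / 2)) \<partial>lborel) \<le>
      (\<integral>\<^sup>+t. ennreal (2 powr (b - 1) / Gamma b) * ?g (t / 2) \<partial>lborel)"
  proof (intro nn_integral_mono)
    fix t :: real
    have "gamma_density b t * exp (t / 2) \<le> 2 powr (b - 1) / Gamma b * (indicator {0..} (t / 2) * (t / 2) powr (b - 1) / exp (t / 2))"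
    proof (cases "t > 0")
      case True
      have "exp t = exp (t / 2) * exp (t / 2)" by (simp add: exp_add[symmetric])
      then show ?thesis
        using True Gamma_real_pos[OF assms] by (simp add: gamma_density_def powr_divide exp_minus field_simps)
    next
      case False
      then show ?thesis using Gamma_real_pos[OF assms] by (simp add: gamma_density_def)
    qed
    then show "ennreal (gamma_density b t * exp (t / 2)) \<le> ennreal (2 powr (b - 1) / Gamma b) * ?g (t / 2)"
      using Gamma_real_pos[OF assms] by (simp add: ennreal_mult[symmetric] ennreal_leI)
  qed
  also have "\<dots> = ennreal (2 powr (b - 1) / Gamma b) * (\<integral>\<^sup>+t. ?g (t / 2) \<partial>lborel)"
    by (rule nn_integral_cmult) measurable
  also have "\<dots> < \<infinity>"
    using fin by (simp add: ennreal_mult_less_top)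
  finally show ?thesis .
qed

lemma bessel_potential_eq:
  assumes "\<beta> > 0"
  shows "bessel_potential \<beta> f n = (\<integral>\<tau>. gamma_density (\<beta> / 2) \<tau> * heat_semigroup \<tau> f n \<partial>lborel)"
proof -
  have "bessel_potential \<beta> f n = (\<integral>\<tau>. 1 / Gamma (\<beta> / 2) *
      (indicator {0<..} \<tau> *\<^sub>R (exp (- \<tau>) * heat_semigroup \<tau> f n * \<tau> powr (\<beta> / 2) / \<tau>)) \<partial>lborel)"
    unfolding bessel_potential_def set_lebesgue_integral_def
    by (rule integral_mult_right_zero[symmetric])
  also have "\<dots> = (\<integral>\<tau>. gamma_density (\<beta> / 2) \<tau> * heat_semigroup \<tau> f n \<partial>lborel)"
    by (intro Bochner_Integration.integral_cong)
      (auto simp: gamma_density_def indicator_def powr_diff mult_ac)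
  finally show ?thesis .
qed

lemma measurable_indicator_heat:
  assumes "exp_growth f"
  shows "(\<lambda>\<tau>. indicator {0<..} \<tau> * heat_semigroup \<tau> f n) \<in> borel_measurable borel"
  using borel_measurable_continuous_on_indicator[OF _ continuous_on_heat[OF assms, of n]] by simp

lemma measurable_gamma_heat:
  assumes "exp_growth f"
  shows "(\<lambda>\<tau>. gamma_density b \<tau> * heat_semigroup \<tau> f n) \<in> borel_measurable borel"
proof -
  note [measurable] = measurable_indicator_heat[OF assms, of n]
  have "(\<lambda>\<tau>. gamma_density b \<tau> * (indicator {0<..} \<tau> * heat_semigroup \<tau> f n)) \<in> borel_measurable borel"
    by measurable
  also have "(\<lambda>\<tau>. gamma_density b \<tau> * (indicator {0<..} \<tau> * heat_semigroup \<tau> f n)) =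
      (\<lambda>\<tau>. gamma_density b \<tau> * heat_semigroup \<tau> f n)"
    by (auto simp: gamma_density_def indicator_def fun_eq_iff)
  finally show ?thesis .
qed

lemma abs_gamma_heat_le:
  assumes "b > 0" "\<And>n. \<bar>f n\<bar> \<le> C * geo_weight n"
  shows "\<bar>gamma_density b \<tau> * heat_semigroup \<tau> f n\<bar> \<le>
    C * geo_weight n * (gamma_density b \<tau> * exp (\<tau> / 2))"
proof (cases "\<tau> > 0")
  case True
  have "gamma_density b \<tau> * \<bar>heat_semigroup \<tau> f n\<bar> \<le> gamma_density b \<tau> * (C * exp (\<tau> / 2) * geo_weight n)"
    by (intro mult_left_mono abs_heat_le assms True gamma_density_nonneg)
  then show ?thesis
    using gamma_density_nonneg[OF assms(1)] by (simp add: abs_mult mult_ac)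
qed (simp add: gamma_density_def)

lemma nn_integral_gamma_heat_le:
  assumes "b > 0" "C \<ge> 0" "\<And>n. \<bar>f n\<bar> \<le> C * geo_weight n"
  shows "(\<integral>\<^sup>+\<tau>. ennreal \<bar>gamma_density b \<tau> * heat_semigroup \<tau> f n\<bar> \<partial>lborel) \<le>
    ennreal (C * geo_weight n) * (\<integral>\<^sup>+\<tau>. ennreal (gamma_density b \<tau> * exp (\<tau> / 2)) \<partial>lborel)"
proof -
  have "(\<integral>\<^sup>+\<tau>. ennreal \<bar>gamma_density b \<tau> * heat_semigroup \<tau> f n\<bar> \<partial>lborel) \<le>
      (\<integral>\<^sup>+\<tau>. ennreal (C * geo_weight n) * ennreal (gamma_density b \<tau> * exp (\<tau> / 2)) \<partial>lborel)"
    using abs_gamma_heat_le[OF assms(1,3)] assms(2) geo_weight_pos[of n] gamma_density_nonneg[OF assms(1)]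
    by (intro nn_integral_mono) (simp add: ennreal_mult[symmetric] ennreal_leI)
  also have "\<dots> = ennreal (C * geo_weight n) * (\<integral>\<^sup>+\<tau>. ennreal (gamma_density b \<tau> * exp (\<tau> / 2)) \<partial>lborel)"
    by (rule nn_integral_cmult) measurable
  finally show ?thesis .
qed

lemma integrable_gamma_heat:
  assumes "b > 0" "exp_growth f"
  shows "integrable lborel (\<lambda>\<tau>. gamma_density b \<tau> * heat_semigroup \<tau> f n)"
proof (rule integrableI_bounded)
  obtain C where C: "C \<ge> 0" "\<And>n. \<bar>f n\<bar> \<le> C * geo_weight n"
    using assms(2) by (meson exp_growthE)
  show "(\<integral>\<^sup>+\<tau>. ennreal (norm (gamma_density b \<tau> * heat_semigroup \<tau> f n)) \<partial>lborel) < \<infinity>"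
    unfolding real_norm_def
    by (rule le_less_trans[OF nn_integral_gamma_heat_le[OF assms(1) C]])
      (use nn_integral_gamma_density_finite[OF assms(1)] in \<open>simp add: ennreal_mult_less_top\<close>)
qed (use measurable_gamma_heat[OF assms(2)] in simp)

lemma abs_bessel_le_nn_integral:
  assumes "\<beta> > 0"
  shows "ennreal \<bar>bessel_potential \<beta> f n\<bar> \<le>
    (\<integral>\<^sup>+\<tau>. ennreal \<bar>gamma_density (\<beta> / 2) \<tau> * heat_semigroup \<tau> f n\<bar> \<partial>lborel)"
  unfolding bessel_potential_eq[OF assms]
  using integral_norm_bound_ennreal[of lborel "\<lambda>\<tau>. gamma_density (\<beta> / 2) \<tau> * heat_semigroup \<tau> f n"]
  by (cases "integrable lborel (\<lambda>\<tau>. gamma_density (\<beta> / 2) \<tau> * heat_semigroup \<tau> f n)")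
    (auto simp: not_integrable_integral_eq)

lemma exp_growth_bessel:
  assumes "\<beta> > 0" "exp_growth f"
  shows "exp_growth (bessel_potential \<beta> f)"
proof -
  obtain C where C: "C \<ge> 0" "\<And>n. \<bar>f n\<bar> \<le> C * geo_weight n"
    using assms(2) by (meson exp_growthE)
  have b: "\<beta> / 2 > 0" using assms(1) by simp
  obtain K where K: "K \<ge> 0" "(\<integral>\<^sup>+\<tau>. ennreal (gamma_density (\<beta> / 2) \<tau> * exp (\<tau> / 2)) \<partial>lborel) = ennreal K"
    using nn_integral_gamma_density_finite[OF b]
    by (cases "\<integral>\<^sup>+\<tau>. ennreal (gamma_density (\<beta> / 2) \<tau> * exp (\<tau> / 2)) \<partial>lborel") auto
  have "\<bar>bessel_potential \<beta> f n\<bar> \<le> (C * K) * geo_weight n" for n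
  proof -
    have "ennreal \<bar>bessel_potential \<beta> f n\<bar> \<le> ennreal (C * geo_weight n) * ennreal K"
      using order_trans[OF abs_bessel_le_nn_integral[OF assms(1)] nn_integral_gamma_heat_le[OF b C]]
      unfolding K(2) .
    also have "\<dots> = ennreal (C * K * geo_weight n)"
      using C K geo_weight_pos[of n] by (simp add: ennreal_mult[symmetric] mult_ac)
    finally show ?thesis
      using C(1) K(1) geo_weight_pos[of n] by (simp add: ennreal_le_iff)
  qed
  then show ?thesis by (rule exp_growthI)
qed

lemma lap_bessel:
  assumes "\<beta> > 0" "exp_growth f"
  shows "lap (bessel_potential \<beta> f) = bessel_potential \<beta> (lap f)"
proof
  fix n
  let ?g = "gamma_density (\<beta> / 2)"
  have b: "\<beta> / 2 > 0" using assms(1) by simp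
  note int = integrable_gamma_heat[OF b assms(2)]
  have "bessel_potential \<beta> (lap f) n = (\<integral>\<tau>. ?g \<tau> * heat_semigroup \<tau> f (n + 1)
      - 2 * (?g \<tau> * heat_semigroup \<tau> f n) + ?g \<tau> * heat_semigroup \<tau> f (n - 1) \<partial>lborel)"
    unfolding bessel_potential_eq[OF assms(1)]
  proof (intro Bochner_Integration.integral_cong refl)
    fix \<tau> :: real
    show "?g \<tau> * heat_semigroup \<tau> (lap f) n = ?g \<tau> * heat_semigroup \<tau> f (n + 1)
      - 2 * (?g \<tau> * heat_semigroup \<tau> f n) + ?g \<tau> * heat_semigroup \<tau> f (n - 1)"
    proof (cases "\<tau> > 0")
      case True
      then have "heat_semigroup \<tau> (lap f) = lap (heat_semigroup \<tau> f)"
        using heat_lap_power[OF True assms(2), of 1] by simp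
      then show ?thesis by (simp add: lap_def algebra_simps)
    qed (simp add: gamma_density_def)
  qed
  also have "\<dots> = lap (bessel_potential \<beta> f) n"
    using int by (simp add: lap_def bessel_potential_eq[OF assms(1)])
  finally show "lap (bessel_potential \<beta> f) n = bessel_potential \<beta> (lap f) n" by simp
qed

lemma lap_power_bessel:
  assumes "\<beta> > 0" "exp_growth f"
  shows "(lap ^^ k) (bessel_potential \<beta> f) = bessel_potential \<beta> ((lap ^^ k) f)"
  by (induction k) (simp_all add: lap_bessel assms exp_growth_lap_power)

text \<open>
  The semigroup law under the integral that defines the Bessel potential.
\<close>

lemma heat_bessel:
  assumes "\<beta> > 0" "t > 0" "exp_growth f"
  shows "heat_semigroup t (bessel_potential \<beta> f) n =
    (\<integral>\<tau>. gamma_density (\<beta> / 2) \<tau> * heat_semigroup (t + \<tau>) f n \<partial>lborel)"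
proof -
  let ?G = "heat_kernel t" and ?g = "gamma_density (\<beta> / 2)"
  let ?h = "\<lambda>j \<tau>. ?G (n - j) * (?g \<tau> * heat_semigroup \<tau> f j)"
  interpret pair_sigma_finite counting "lborel :: real measure"
    by (simp add: pair_sigma_finite_def sigma_finite_counting sigma_finite_lborel)
  obtain C where C: "C \<ge> 0" "\<And>n. \<bar>f n\<bar> \<le> C * geo_weight n"
    using assms(3) by (meson exp_growthE)
  have b: "\<beta> / 2 > 0" using assms(1) by simp
  obtain K where K: "K \<ge> 0" "(\<integral>\<^sup>+\<tau>. ennreal (?g \<tau> * exp (\<tau> / 2)) \<partial>lborel) = ennreal K"
    using nn_integral_gamma_density_finite[OF b]
    by (cases "\<integral>\<^sup>+\<tau>. ennreal (?g \<tau> * exp (\<tau> / 2)) \<partial>lborel") auto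
  note [measurable] = measurable_gamma_heat[OF assms(3)]
  have meas: "case_prod ?h \<in> borel_measurable (counting \<Otimes>\<^sub>M lborel)"
    by (rule measurable_pair_measure_countable1) auto
  have int: "integrable (counting \<Otimes>\<^sub>M lborel) (case_prod ?h)"
  proof (rule integrableI_bounded)
    have "(\<integral>\<^sup>+x. ennreal (norm (case_prod ?h x)) \<partial>(counting \<Otimes>\<^sub>M lborel)) =
        (\<integral>\<^sup>+j. \<integral>\<^sup>+\<tau>. ennreal \<bar>?h j \<tau>\<bar> \<partial>lborel \<partial>counting)"
      using meas by (subst lborel.nn_integral_fst[symmetric]) auto
    also have "\<dots> = (\<integral>\<^sup>+j. ennreal \<bar>?G (n - j)\<bar> * (\<integral>\<^sup>+\<tau>. ennreal \<bar>?g \<tau> * heat_semigroup \<tau> f j\<bar> \<partial>lborel) \<partial>counting)"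
    proof (intro nn_integral_cong)
      fix j
      have "ennreal \<bar>?h j \<tau>\<bar> = ennreal \<bar>?G (n - j)\<bar> * ennreal \<bar>?g \<tau> * heat_semigroup \<tau> f j\<bar>" for \<tau>
        by (simp add: abs_mult[of "?G (n - j)"] ennreal_mult)
      then show "(\<integral>\<^sup>+\<tau>. ennreal \<bar>?h j \<tau>\<bar> \<partial>lborel) =
          ennreal \<bar>?G (n - j)\<bar> * (\<integral>\<^sup>+\<tau>. ennreal \<bar>?g \<tau> * heat_semigroup \<tau> f j\<bar> \<partial>lborel)"
        by (simp only:) (rule nn_integral_cmult, measurable)
    qed
    also have "\<dots> \<le> (\<integral>\<^sup>+j. ennreal \<bar>?G (n - j)\<bar> * (ennreal (C * geo_weight j) * ennreal K) \<partial>counting)"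
      using nn_integral_gamma_heat_le[OF b C] unfolding K(2) by (intro nn_integral_mono mult_left_mono) auto
    also have "\<dots> = (\<integral>\<^sup>+j. ennreal \<bar>?G (n - j) * (C * K * geo_weight j)\<bar> \<partial>counting)"
      using C(1) K(1) by (intro nn_integral_cong)
        (simp add: abs_mult ennreal_mult less_imp_le[OF geo_weight_pos] mult_ac)
    also have "\<dots> \<le> ennreal (C * K * geo_weight n) * geo_norm ?G"
      using C(1) K(1) by (intro nn_integral_geo_le) (simp add: abs_mult less_imp_le[OF geo_weight_pos])
    also have "\<dots> < \<infinity>"
      using geo_norm_heat_kernel_finite[OF assms(2)] by (simp add: ennreal_mult_less_top)
    finally show "(\<integral>\<^sup>+x. ennreal (norm (case_prod ?h x)) \<partial>(counting \<Otimes>\<^sub>M lborel)) < \<infinity>" .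
  qed (rule meas)
  have "heat_semigroup t (bessel_potential \<beta> f) n = (\<integral>j. (\<integral>\<tau>. ?h j \<tau> \<partial>lborel) \<partial>counting)"
    by (simp add: heat_semigroup_eq_conv conv_def bessel_potential_eq[OF assms(1)])
  also have "\<dots> = (\<integral>\<tau>. (\<integral>j. ?h j \<tau> \<partial>counting) \<partial>lborel)"
    by (rule Fubini_integral[OF int, symmetric])
  also have "\<dots> = (\<integral>\<tau>. ?g \<tau> * heat_semigroup (t + \<tau>) f n \<partial>lborel)"
  proof (intro Bochner_Integration.integral_cong refl)
    fix \<tau> :: real
    show "(\<integral>j. ?h j \<tau> \<partial>counting) = ?g \<tau> * heat_semigroup (t + \<tau>) f n"
    proof (cases "\<tau> > 0")
      case True
      have "(\<integral>j. ?h j \<tau> \<partial>counting) = ?g \<tau> * conv ?G (heat_semigroup \<tau> f) n"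
        unfolding conv_def by (subst integral_mult_right_zero[symmetric]) (simp add: mult_ac)
      then show ?thesis
        using heat_semigroup_add[OF assms(2) True assms(3)] by (simp add: heat_semigroup_eq_conv)
    qed (simp add: gamma_density_def)
  qed
  finally show ?thesis .
qed

section \<open>Averages over dilations in the mixed norm\<close>

text \<open>
  A Beta integral: comparison with \<open>r powr (b - 1)\<close> near \<open>0\<close> and with \<open>r powr (b - 1 - c)\<close> near infinity.
\<close>

lemma nn_integral_beta_weight_finite:
  fixes b c :: real
  assumes "b > 0" "c > b"
  shows "(\<integral>\<^sup>+r. ennreal (indicator {0<..} r * (r powr (b - 1) * (1 + r) powr (- c))) \<partial>lborel) < \<infinity>"
proof -
  let ?f = "\<lambda>r::real. indicator {0..1} r * r powr (b - 1)" and ?g = "\<lambda>r::real. indicator {1..} r * r powr (b - 1 - c)"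
  have "((\<lambda>r. r powr (b - 1)) has_integral (1 powr (b - 1 + 1) / (b - 1 + 1))) {0..1}"
    by (rule has_integral_powr_from_0) (use assms in auto)
  then have f: "(\<integral>\<^sup>+r. ennreal (?f r) \<partial>lborel) < \<infinity>"
    by (subst nn_integral_has_integral_lebesgue) auto
  have "((\<lambda>r. r powr (b - 1 - c)) has_integral (- (1 powr (b - 1 - c + 1)) / (b - 1 - c + 1))) {1..}"
    by (rule has_integral_powr_to_inf) (use assms in auto)
  then have g: "(\<integral>\<^sup>+r. ennreal (?g r) \<partial>lborel) < \<infinity>"
    by (subst nn_integral_has_integral_lebesgue) auto
  have "(\<integral>\<^sup>+r. ennreal (indicator {0<..} r * (r powr (b - 1) * (1 + r) powr (- c))) \<partial>lborel) \<le>
      (\<integral>\<^sup>+r. ennreal (?f r) + ennreal (?g r) \<partial>lborel)"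
  proof (intro nn_integral_mono)
    fix r :: real
    have "indicator {0<..} r * (r powr (b - 1) * (1 + r) powr (- c)) \<le> ?f r + ?g r"
    proof (cases "r > 0")
      case r: True
      show ?thesis
      proof (cases "r \<le> 1")
        case True
        have "(1 + r) powr (- c) \<le> 1 powr (- c)"
          using r assms by (intro powr_mono2') auto
        then have "r powr (b - 1) * (1 + r) powr (- c) \<le> r powr (b - 1) * 1"
          by (intro mult_left_mono) auto
        then have "indicator {0<..} r * (r powr (b - 1) * (1 + r) powr (- c)) \<le> ?f r"
          using r True by (simp add: indicator_def)
        moreover have "0 \<le> ?g r" by simp
        ultimately show ?thesis by linarith
      next
        case False
        have "(1 + r) powr (- c) \<le> r powr (- c)"
          using r assms by (intro powr_mono2') auto
        then have "r powr (b - 1) * (1 + r) powr (- c) \<le> r powr (b - 1) * r powr (- c)"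
          by (intro mult_left_mono) auto
        also have "\<dots> = r powr (b - 1 - c)"
          by (simp add: powr_add[symmetric])
        finally show ?thesis using r False by (simp add: indicator_def)
      qed
    qed (simp add: indicator_def)
    then show "ennreal (indicator {0<..} r * (r powr (b - 1) * (1 + r) powr (- c))) \<le> ennreal (?f r) + ennreal (?g r)"
      by (simp add: ennreal_plus[symmetric] ennreal_leI del: ennreal_plus)
  qed
  also have "\<dots> = (\<integral>\<^sup>+r. ennreal (?f r) \<partial>lborel) + (\<integral>\<^sup>+r. ennreal (?g r) \<partial>lborel)"
    by (rule nn_integral_add) measurable
  also have "\<dots> < \<infinity>" using f g by simp
  finally show ?thesis .
qed

text \<open>
  Invariance of the measure \<open>dt / t\<close> on the positive half-line under dilations.
\<close>

lemma nn_integral_dilate: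
  fixes \<phi> :: "real \<Rightarrow> ennreal"
  assumes [measurable]: "\<phi> \<in> borel_measurable borel" and c: "c > 0"
  shows "(\<integral>\<^sup>+t\<in>{0<..}. \<phi> (c * t) * ennreal (1 / t) \<partial>lborel) = (\<integral>\<^sup>+t\<in>{0<..}. \<phi> t * ennreal (1 / t) \<partial>lborel)"
proof -
  have "(\<integral>\<^sup>+t\<in>{0<..}. \<phi> t * ennreal (1 / t) \<partial>lborel) =
      ennreal c * (\<integral>\<^sup>+t. \<phi> (c * t) * ennreal (1 / (c * t)) * indicator {0<..} (c * t) \<partial>lborel)"
    using nn_integral_real_affine[of "\<lambda>t. \<phi> t * ennreal (1 / t) * indicator {0<..} t" c 0] c by simp
  also have "\<dots> = (\<integral>\<^sup>+t. ennreal c * (\<phi> (c * t) * ennreal (1 / (c * t)) * indicator {0<..} (c * t)) \<partial>lborel)"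
    by (rule nn_integral_cmult[symmetric]) measurable
  also have "\<dots> = (\<integral>\<^sup>+t\<in>{0<..}. \<phi> (c * t) * ennreal (1 / t) \<partial>lborel)"
  proof (intro nn_integral_cong)
    fix t :: real
    show "ennreal c * (\<phi> (c * t) * ennreal (1 / (c * t)) * indicator {0<..} (c * t)) =
        \<phi> (c * t) * ennreal (1 / t) * indicator {0<..} t"
    proof (cases "t > 0")
      case True
      have "ennreal c * ennreal (1 / (c * t)) = ennreal (1 / t)"
        using c True by (simp add: ennreal_mult[symmetric])
      moreover have "ennreal c * (\<phi> (c * t) * ennreal (1 / (c * t))) =
          \<phi> (c * t) * (ennreal c * ennreal (1 / (c * t)))"
        by (rule mult.left_commute[THEN trans]) (rule refl)
      ultimately show ?thesis using True c by (simp only:) (simp add: zero_less_mult_iff)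
    qed (use c in \<open>simp add: zero_less_mult_iff\<close>)
  qed
  finally show ?thesis by simp
qed

text \<open>
  For fixed \<open>t\<close>, the map \<open>r \<mapsto> t (1 + r) / 2\<close> is affine, so it pulls null sets back to null sets and the essential bound of
  \<open>v\<close> holds for almost every \<open>r\<close>.
\<close>

lemma esssup_average_finite:
  fixes v H w :: "real \<Rightarrow> ennreal"
  assumes [measurable]: "v \<in> borel_measurable borel" "w \<in> borel_measurable borel"
    and w: "(\<integral>\<^sup>+r. w r \<partial>lborel) < \<infinity>"
    and le: "\<And>t. t > 0 \<Longrightarrow> H t \<le> (\<integral>\<^sup>+r. w r * v (t / 2 + t / 2 * r) \<partial>lborel)"
    and fin: "AE t in lborel. v t \<le> B" "B < \<infinity>"
  shows "\<exists>B'<\<infinity>. \<forall>t>0. H t \<le> B'"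
proof (intro exI conjI allI impI)
  show "(\<integral>\<^sup>+r. w r \<partial>lborel) * B < \<infinity>"
    using w fin(2) by (simp add: ennreal_mult_less_top)
  fix t :: real assume t: "t > 0"
  have "AE r in lborel. v (t / 2 + t / 2 * r) \<le> B"
    using t fin(1) by (intro AE_borel_affine[of "t / 2" "\<lambda>t. v t \<le> B"]) auto
  then have "(\<integral>\<^sup>+r. w r * v (t / 2 + t / 2 * r) \<partial>lborel) \<le> (\<integral>\<^sup>+r. w r * B \<partial>lborel)"
    by (intro nn_integral_mono_AE) (auto elim!: eventually_mono intro: mult_left_mono)
  also have "\<dots> = (\<integral>\<^sup>+r. w r \<partial>lborel) * B"
    by (rule nn_integral_multc) measurable
  finally show "H t \<le> (\<integral>\<^sup>+r. w r \<partial>lborel) * B"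
    using le[OF t] by simp
qed

text \<open>
  Jensen's inequality in \<open>r\<close>, then Tonelli's theorem; for each \<open>r\<close> the integral in \<open>t\<close> is that of \<open>v\<close>, by dilation
  invariance.
\<close>

lemma lq_average_finite:
  fixes v H w :: "real \<Rightarrow> ennreal"
  assumes [measurable]: "v \<in> borel_measurable borel" "w \<in> borel_measurable borel"
    and w: "(\<integral>\<^sup>+r. w r \<partial>lborel) < \<infinity>" "\<And>r. r \<le> 0 \<Longrightarrow> w r = 0"
    and le: "\<And>t. t > 0 \<Longrightarrow> H t \<le> (\<integral>\<^sup>+r. w r * v (t / 2 + t / 2 * r) \<partial>lborel)"
    and q: "q \<ge> 1"
    and fin: "(\<integral>\<^sup>+t\<in>{0<..}. ennpowr (v t) q * ennreal (1 / t) \<partial>lborel) < \<infinity>"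
  shows "(\<integral>\<^sup>+t\<in>{0<..}. ennpowr (H t) q * ennreal (1 / t) \<partial>lborel) < \<infinity>"
proof -
  let ?I = "\<integral>\<^sup>+t\<in>{0<..}. ennpowr (v t) q * ennreal (1 / t) \<partial>lborel"
  \<comment> \<open>The summand 1 keeps \<open>K\<close> positive, so that dividing by it also makes sense for \<open>w = 0\<close>.\<close>
  define K where "K = enn2real (\<integral>\<^sup>+r. w r \<partial>lborel) + 1"
  have K: "K > 0" by (simp add: K_def add_nonneg_pos)
  have wK: "(\<integral>\<^sup>+r. w r \<partial>lborel) \<le> ennreal K"
    using w(1) by (cases "\<integral>\<^sup>+r. w r \<partial>lborel") (auto simp: K_def)
  let ?w = "\<lambda>r. w r * ennreal (1 / K)"
  have "(\<integral>\<^sup>+r. ?w r \<partial>lborel) = (\<integral>\<^sup>+r. w r \<partial>lborel) * ennreal (1 / K)"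
    by (rule nn_integral_multc) measurable
  also have "\<dots> \<le> ennreal K * ennreal (1 / K)"
    by (intro mult_right_mono wK) simp
  also have "\<dots> = 1"
    using K by (simp add: ennreal_mult[symmetric])
  finally have unit: "(\<integral>\<^sup>+r. ?w r \<partial>lborel) \<le> 1" .
  have KK: "ennreal K * ennreal (1 / K) = 1"
    using K by (simp add: ennreal_mult[symmetric])
  have pw: "ennpowr (H t) q \<le> ennpowr (ennreal K) q * (\<integral>\<^sup>+r. ?w r * ennpowr (v (t / 2 + t / 2 * r)) q \<partial>lborel)"
    if t: "t > 0" for t
  proof -
    have "(\<integral>\<^sup>+r. w r * v (t / 2 + t / 2 * r) \<partial>lborel) =
        (\<integral>\<^sup>+r. ennreal K * (?w r * v (t / 2 + t / 2 * r)) \<partial>lborel)"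
    proof (intro nn_integral_cong)
      fix r
      have "ennreal K * (?w r * v (t / 2 + t / 2 * r)) =
          (ennreal K * ennreal (1 / K)) * (w r * v (t / 2 + t / 2 * r))"
        by (simp only: mult_ac)
      then show "w r * v (t / 2 + t / 2 * r) = ennreal K * (?w r * v (t / 2 + t / 2 * r))"
        unfolding KK by simp
    qed
    also have "\<dots> = ennreal K * (\<integral>\<^sup>+r. ?w r * v (t / 2 + t / 2 * r) \<partial>lborel)"
      by (rule nn_integral_cmult) measurable
    finally have "ennpowr (H t) q \<le> ennpowr (ennreal K * (\<integral>\<^sup>+r. ?w r * v (t / 2 + t / 2 * r) \<partial>lborel)) q"
      using le[OF t] q by (intro ennpowr_mono) auto
    also have "\<dots> = ennpowr (ennreal K) q * ennpowr (\<integral>\<^sup>+r. ?w r * v (t / 2 + t / 2 * r) \<partial>lborel) q"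
      using q by (intro ennpowr_mult) auto
    also have "\<dots> \<le> ennpowr (ennreal K) q * (\<integral>\<^sup>+r. ?w r * ennpowr (v (t / 2 + t / 2 * r)) q \<partial>lborel)"
      by (intro mult_left_mono powr_nn_integral_le unit q) auto
    finally show ?thesis .
  qed
  have "(\<integral>\<^sup>+t\<in>{0<..}. ennpowr (H t) q * ennreal (1 / t) \<partial>lborel) \<le>
      (\<integral>\<^sup>+t. ennpowr (ennreal K) q * (\<integral>\<^sup>+r. ?w r * (ennpowr (v ((1 + r) / 2 * t)) q * ennreal (1 / t) * indicator {0<..} t) \<partial>lborel) \<partial>lborel)"
  proof (intro nn_integral_mono)
    fix t :: real
    show "ennpowr (H t) q * ennreal (1 / t) * indicator {0<..} t \<le>
      ennpowr (ennreal K) q * (\<integral>\<^sup>+r. ?w r * (ennpowr (v ((1 + r) / 2 * t)) q * ennreal (1 / t) * indicator {0<..} t) \<partial>lborel)"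
    proof (cases "t > 0")
      case True
      have eq: "(1 + r) / 2 * t = t / 2 + t / 2 * r" for r :: real
        by (simp add: field_simps)
      have "(\<integral>\<^sup>+r. ?w r * (ennpowr (v ((1 + r) / 2 * t)) q * ennreal (1 / t) * indicator {0<..} t) \<partial>lborel) =
          (\<integral>\<^sup>+r. ?w r * ennpowr (v (t / 2 + t / 2 * r)) q * ennreal (1 / t) \<partial>lborel)"
        unfolding eq using True by (simp add: mult.assoc)
      also have "\<dots> = (\<integral>\<^sup>+r. ?w r * ennpowr (v (t / 2 + t / 2 * r)) q \<partial>lborel) * ennreal (1 / t)"
        by (rule nn_integral_multc) measurable
      finally show ?thesis
        using mult_right_mono[OF pw[OF True], of "ennreal (1 / t)"] True by (simp add: mult.assoc)
    qed simp
  qed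
  also have "\<dots> = ennpowr (ennreal K) q *
      (\<integral>\<^sup>+t. \<integral>\<^sup>+r. ?w r * (ennpowr (v ((1 + r) / 2 * t)) q * ennreal (1 / t) * indicator {0<..} t) \<partial>lborel \<partial>lborel)"
    by (rule nn_integral_cmult) measurable
  also have "(\<integral>\<^sup>+t. \<integral>\<^sup>+r. ?w r * (ennpowr (v ((1 + r) / 2 * t)) q * ennreal (1 / t) * indicator {0<..} t) \<partial>lborel \<partial>lborel) =
      (\<integral>\<^sup>+r. \<integral>\<^sup>+t. ?w r * (ennpowr (v ((1 + r) / 2 * t)) q * ennreal (1 / t) * indicator {0<..} t) \<partial>lborel \<partial>lborel)"
    by (rule lborel_pair.Fubini') measurable
  also have "\<dots> = (\<integral>\<^sup>+r. ?w r * ?I \<partial>lborel)"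
  proof (intro nn_integral_cong)
    fix r :: real
    show "(\<integral>\<^sup>+t. ?w r * (ennpowr (v ((1 + r) / 2 * t)) q * ennreal (1 / t) * indicator {0<..} t) \<partial>lborel) = ?w r * ?I"
    proof (cases "r > 0")
      case True
      have "(\<integral>\<^sup>+t. ?w r * (ennpowr (v ((1 + r) / 2 * t)) q * ennreal (1 / t) * indicator {0<..} t) \<partial>lborel)
        = ?w r * (\<integral>\<^sup>+t\<in>{0<..}. ennpowr (v ((1 + r) / 2 * t)) q * ennreal (1 / t) \<partial>lborel)"
        by (rule nn_integral_cmult) measurable
      also have "\<dots> = ?w r * ?I"
        using True nn_integral_dilate[of "\<lambda>t. ennpowr (v t) q" "(1 + r) / 2"] by simp
      finally show ?thesis .
    qed (use w(2) in simp)
  qed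
  also have "\<dots> = (\<integral>\<^sup>+r. ?w r \<partial>lborel) * ?I"
    by (rule nn_integral_multc) measurable
  also have "ennpowr (ennreal K) q * ((\<integral>\<^sup>+r. ?w r \<partial>lborel) * ?I) < \<infinity>"
  proof -
    have "(\<integral>\<^sup>+r. ?w r \<partial>lborel) * ?I \<le> 1 * ?I"
      by (intro mult_right_mono unit) simp
    also have "\<dots> < \<infinity>" using fin by simp
    finally have "(\<integral>\<^sup>+r. ?w r \<partial>lborel) * ?I < \<infinity>" .
    moreover have "ennpowr (ennreal K) q < \<infinity>"
      unfolding ennpowr_less_top_iff by simp
    ultimately show ?thesis
      unfolding infinity_ennreal_def ennreal_mult_less_top by blast
  qed
  finally show ?thesis .
qed

lemma mixed_norm_average_finite:
  fixes F G :: "real \<Rightarrow> int \<Rightarrow> real" and w :: "real \<Rightarrow> ennreal"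
  assumes p: "p \<ge> 1" and q: "q \<ge> 1"
    and F: "\<And>n. (\<lambda>t. indicator {0<..} t * F t n) \<in> borel_measurable borel"
    and G: "\<And>n. (\<lambda>t. indicator {0<..} t * G t n) \<in> borel_measurable borel"
    and w: "w \<in> borel_measurable borel" "(\<integral>\<^sup>+r. w r \<partial>lborel) < \<infinity>" "\<And>r. r \<le> 0 \<Longrightarrow> w r = 0"
    and le: "\<And>t. t > 0 \<Longrightarrow> lp_norm p (G t) \<le> (\<integral>\<^sup>+r. w r * lp_norm p (F (t / 2 + t / 2 * r)) \<partial>lborel)"
    and fin: "mixed_norm p q F < \<infinity>"
  shows "mixed_norm p q G < \<infinity>"
proof -
  define v where "v t = lp_norm p (\<lambda>n. indicator {0<..} t * F t n)" for t :: real
  define H where "H t = lp_norm p (\<lambda>n. indicator {0<..} t * G t n)" for t :: real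
  have [measurable]: "v \<in> borel_measurable borel" "H \<in> borel_measurable borel"
    unfolding v_def[abs_def] H_def[abs_def] by (rule measurable_lp_norm F G)+
  note [measurable] = w(1)
  have v: "v t = lp_norm p (F t)" and H: "H t = lp_norm p (G t)" if "t > 0" for t
    using that by (simp_all add: v_def H_def)
  have le': "H t \<le> (\<integral>\<^sup>+r. w r * v (t / 2 + t / 2 * r) \<partial>lborel)" if t: "t > 0" for t
  proof -
    have "w r * lp_norm p (F (t / 2 + t / 2 * r)) = w r * v (t / 2 + t / 2 * r)" for r
      using t w(3)[of r] by (cases "r > 0") (simp_all add: v add_pos_pos)
    then show ?thesis using le[OF t] t by (simp add: H)
  qed
  show ?thesis
  proof (cases "q = \<infinity>")
    case True
    let ?M = "restrict_space lborel {0::real<..}"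
    define B where "B = mixed_norm p q F"
    have "AE t in ?M. lp_norm p (F t) \<le> B"
      unfolding B_def mixed_norm_def using True esssup_AE by auto
    then have "AE t in lborel. t > 0 \<longrightarrow> lp_norm p (F t) \<le> B"
      by (subst (asm) AE_restrict_space_iff) auto
    then have "AE t in lborel. v t \<le> B"
    proof eventually_elim
      case (elim t)
      then show ?case
        by (cases "t > 0") (simp_all add: v v_def lp_norm_cmult[OF p, of 0, simplified])
    qed
    then obtain B' where B': "B' < \<infinity>" "\<And>t. t > 0 \<Longrightarrow> H t \<le> B'"
      using esssup_average_finite[of v w H B] w le' fin unfolding B_def by auto
    have "(\<lambda>t. lp_norm p (G t)) \<in> borel_measurable ?M"
    proof -
      have "H \<in> borel_measurable ?M" by (rule measurable_restrict_space1) simp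
      then show ?thesis by (subst measurable_cong[where g=H]) (auto simp: H space_restrict_space)
    qed
    then have "esssup ?M (\<lambda>t. lp_norm p (G t)) \<le> B'"
      by (rule esssup_I) (auto simp: AE_restrict_space_iff H[symmetric] B'(2))
    then show ?thesis using True B'(1) by (simp add: mixed_norm_def le_less_trans)
  next
    case False
    let ?q = "enn2real q"
    have cong: "(\<integral>\<^sup>+t\<in>{0<..}. ennpowr (u t) ?q * ennreal (1 / t) \<partial>lborel) =
      (\<integral>\<^sup>+t\<in>{0<..}. ennpowr (u' t) ?q * ennreal (1 / t) \<partial>lborel)" if "\<And>t. t > 0 \<Longrightarrow> u t = u' t" for u u' :: "real \<Rightarrow> ennreal"
      using that by (intro nn_integral_cong) (auto simp: indicator_def)
    have "(\<integral>\<^sup>+t\<in>{0<..}. ennpowr (v t) ?q * ennreal (1 / t) \<partial>lborel) < \<infinity>"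
      using fin False cong[of v "\<lambda>t. lp_norm p (F t)"] v by (simp add: mixed_norm_def ennpowr_less_top_iff[simplified])
    then have "(\<integral>\<^sup>+t\<in>{0<..}. ennpowr (H t) ?q * ennreal (1 / t) \<partial>lborel) < \<infinity>"
      using enn2real_ge_1[OF False q] w le' by (intro lq_average_finite[of v w H]) auto
    then show ?thesis
      using False cong[of H "\<lambda>t. lp_norm p (G t)"] H by (simp add: mixed_norm_def ennpowr_less_top_iff[simplified])
  qed
qed

section \<open>Time derivatives of Bessel potentials as averages over dilations\<close>

text \<open>
  The key pointwise estimate. The exponent of \<open>1 + r\<close> collects \<open>l - k\<close> from the smoothing estimate and
  \<open>k - \<alpha> / 2\<close> from the normalisation of the \<open>k\<close>-th derivative; the exponent of \<open>r\<close> is that of the Gamma density, whose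
  exponential factor is bounded by one.
\<close>

lemma heat_bessel_average:
  assumes p: "p \<ge> 1" and \<beta>: "\<beta> > 0" and f: "exp_growth f" and kl: "k \<le> l"
  obtains D where "D \<ge> 0"
    "\<And>t. t > 0 \<Longrightarrow> lp_norm p (\<lambda>n. t powr (real l - (\<alpha> + \<beta>) / 2) * heat_semigroup t ((lap ^^ l) (bessel_potential \<beta> f)) n) \<le>
      (\<integral>\<^sup>+r. ennreal (D * (indicator {0<..} r * (r powr (\<beta> / 2 - 1) * (1 + r) powr (- (real l - \<alpha> / 2))))) *
        lp_norm p (\<lambda>n. (t / 2 + t / 2 * r) powr (real k - \<alpha> / 2) *
          heat_semigroup (t / 2 + t / 2 * r) ((lap ^^ k) f) n) \<partial>lborel)"
proof -
  define b where "b = \<beta> / 2"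
  have b: "b > 0" using \<beta> by (simp add: b_def)
  define h where "h = (lap ^^ l) f"
  have h: "exp_growth h" unfolding h_def using f by (rule exp_growth_lap_power)
  define F where "F = (\<lambda>s n. s powr (real k - \<alpha> / 2) * heat_semigroup s ((lap ^^ k) f) n)"
  define v where "v = (\<lambda>s. lp_norm p (\<lambda>n. indicator {0<..} s * F s n))"
  have [measurable]: "(\<lambda>s. indicator {0<..} s * F s n) \<in> borel_measurable borel" for n
  proof -
    note [measurable] = measurable_indicator_heat[OF exp_growth_lap_power[OF f, of k], of n]
    have "(\<lambda>s. s powr (real k - \<alpha> / 2) * (indicator {0<..} s * heat_semigroup s ((lap ^^ k) f) n)) \<in> borel_measurable borel"
      by measurable
    then show ?thesis by (simp add: F_def mult_ac)
  qed
  have [measurable]: "v \<in> borel_measurable borel"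
    unfolding v_def by (rule measurable_lp_norm) measurable
  obtain C where C: "C \<ge> 0" "\<And>t f. t > 0 \<Longrightarrow> exp_growth f \<Longrightarrow>
      lp_norm p (heat_semigroup t ((lap ^^ (l - k)) f)) \<le> ennreal (C * t powr (- real (l - k))) * lp_norm p f"
    using lp_norm_heat_lap_power_le[OF p, of "l - k"] by blast
  have decay: "lp_norm p (heat_semigroup s h) \<le> ennreal (C * (s / 2) powr (\<alpha> / 2 - real l)) * v (s / 2)" if s: "s > 0" for s
  proof -
    have "lp_norm p (heat_semigroup s h) =
        lp_norm p (heat_semigroup (s / 2) ((lap ^^ (l - k)) (heat_semigroup (s / 2) ((lap ^^ k) f))))"
      using heat_halves[OF s f, of "l - k" k] kl by (simp add: h_def)
    also have "\<dots> \<le> ennreal (C * (s / 2) powr (- real (l - k))) * lp_norm p (heat_semigroup (s / 2) ((lap ^^ k) f))"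
      using s f by (intro C exp_growth_heat exp_growth_lap_power) auto
    also have "heat_semigroup (s / 2) ((lap ^^ k) f) = (\<lambda>n. (s / 2) powr (\<alpha> / 2 - real k) * F (s / 2) n)"
      using s by (simp add: F_def fun_eq_iff mult.assoc[symmetric] powr_add[symmetric])
    also have "lp_norm p (\<lambda>n. (s / 2) powr (\<alpha> / 2 - real k) * F (s / 2) n) =
        ennreal ((s / 2) powr (\<alpha> / 2 - real k)) * v (s / 2)"
      using s by (simp add: lp_norm_cmult[OF p] v_def)
    also have "ennreal (C * (s / 2) powr (- real (l - k))) * (ennreal ((s / 2) powr (\<alpha> / 2 - real k)) * v (s / 2)) =
        ennreal (C * (s / 2) powr (- real (l - k)) * (s / 2) powr (\<alpha> / 2 - real k)) * v (s / 2)"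
      using C(1) by (intro ennreal_mult_assoc[symmetric]) auto
    also have "C * (s / 2) powr (- real (l - k)) * (s / 2) powr (\<alpha> / 2 - real k) = C * (s / 2) powr (\<alpha> / 2 - real l)"
      using kl by (simp add: mult.assoc powr_add[symmetric] of_nat_diff)
    finally show ?thesis .
  qed
  define D where "D = C * 2 powr (real l - \<alpha> / 2) / Gamma b"
  have D: "D \<ge> 0"
    using C(1) Gamma_real_pos[OF b] by (simp add: D_def)
  show thesis
  proof (rule that[OF D])
    fix t :: real assume t: "t > 0"
    let ?T = "t powr (real l - (\<alpha> + \<beta>) / 2)"
    let ?\<phi> = "\<lambda>\<tau>. ennreal (gamma_density b \<tau> * (C * ((t + \<tau>) / 2) powr (\<alpha> / 2 - real l))) * v ((t + \<tau>) / 2)"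
    have heat: "heat_semigroup t ((lap ^^ l) (bessel_potential \<beta> f)) n =
        (\<integral>\<tau>. gamma_density b \<tau> * heat_semigroup (t + \<tau>) h n \<partial>lborel)" for n
      unfolding lap_power_bessel[OF \<beta> f] h_def[symmetric] b_def by (rule heat_bessel[OF \<beta> t h])
    have "lp_norm p (heat_semigroup t ((lap ^^ l) (bessel_potential \<beta> f))) \<le>
        (\<integral>\<^sup>+\<tau>. lp_norm p (\<lambda>n. gamma_density b \<tau> * heat_semigroup (t + \<tau>) h n) \<partial>lborel)"
    proof (rule lp_norm_le_nn_integral[OF p])
      fix n
      show "ennreal \<bar>heat_semigroup t ((lap ^^ l) (bessel_potential \<beta> f)) n\<bar> \<le>
          (\<integral>\<^sup>+\<tau>. ennreal \<bar>gamma_density b \<tau> * heat_semigroup (t + \<tau>) h n\<bar> \<partial>lborel)"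
        unfolding heat
        using integral_norm_bound_ennreal[of lborel "\<lambda>\<tau>. gamma_density b \<tau> * heat_semigroup (t + \<tau>) h n"]
        by (cases "integrable lborel (\<lambda>\<tau>. gamma_density b \<tau> * heat_semigroup (t + \<tau>) h n)")
          (auto simp: not_integrable_integral_eq)
      note [measurable] = measurable_indicator_heat[OF h, of n]
      have "(\<lambda>\<tau>. gamma_density b \<tau> * (indicator {0<..} (t + \<tau>) * heat_semigroup (t + \<tau>) h n)) \<in> borel_measurable borel"
        by measurable
      also have "(\<lambda>\<tau>. gamma_density b \<tau> * (indicator {0<..} (t + \<tau>) * heat_semigroup (t + \<tau>) h n)) =
          (\<lambda>\<tau>. gamma_density b \<tau> * heat_semigroup (t + \<tau>) h n)"
        using t by (auto simp: gamma_density_def indicator_def fun_eq_iff)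
      finally show "(\<lambda>\<tau>. gamma_density b \<tau> * heat_semigroup (t + \<tau>) h n) \<in> borel_measurable lborel"
        by simp
    qed
    also have "\<dots> \<le> (\<integral>\<^sup>+\<tau>. ?\<phi> \<tau> \<partial>lborel)"
    proof (intro nn_integral_mono)
      fix \<tau> :: real
      show "lp_norm p (\<lambda>n. gamma_density b \<tau> * heat_semigroup (t + \<tau>) h n) \<le> ?\<phi> \<tau>"
      proof (cases "\<tau> > 0")
        case True
        have "lp_norm p (\<lambda>n. gamma_density b \<tau> * heat_semigroup (t + \<tau>) h n) =
            ennreal (gamma_density b \<tau>) * lp_norm p (heat_semigroup (t + \<tau>) h)"
          using gamma_density_nonneg[OF b] by (simp add: lp_norm_cmult[OF p])
        also have "\<dots> \<le> ennreal (gamma_density b \<tau>) *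
            (ennreal (C * ((t + \<tau>) / 2) powr (\<alpha> / 2 - real l)) * v ((t + \<tau>) / 2))"
          using True t by (intro mult_left_mono decay) auto
        also have "\<dots> = ?\<phi> \<tau>"
          using C(1) gamma_density_nonneg[OF b] by (intro ennreal_mult_assoc[symmetric]) auto
        finally show ?thesis .
      next
        case False
        then have "gamma_density b \<tau> = 0" by (simp add: gamma_density_def)
        then show ?thesis using lp_norm_cmult[OF p, of 0] by simp
      qed
    qed
    also have "\<dots> = ennreal t * (\<integral>\<^sup>+r. ?\<phi> (t * r) \<partial>lborel)"
      using nn_integral_real_affine[of ?\<phi> t 0] t by simp
    finally have le: "lp_norm p (heat_semigroup t ((lap ^^ l) (bessel_potential \<beta> f))) \<le>
        ennreal t * (\<integral>\<^sup>+r. ?\<phi> (t * r) \<partial>lborel)" .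
    have "lp_norm p (\<lambda>n. ?T * heat_semigroup t ((lap ^^ l) (bessel_potential \<beta> f)) n) \<le>
        ennreal ?T * (ennreal t * (\<integral>\<^sup>+r. ?\<phi> (t * r) \<partial>lborel))"
      unfolding lp_norm_cmult[OF p] using le by (simp add: mult_left_mono)
    also have "\<dots> = ennreal (?T * t) * (\<integral>\<^sup>+r. ?\<phi> (t * r) \<partial>lborel)"
      using t by (intro ennreal_mult_assoc[symmetric]) auto
    also have "\<dots> = (\<integral>\<^sup>+r. ennreal (?T * t) * ?\<phi> (t * r) \<partial>lborel)"
      by (rule nn_integral_cmult[symmetric]) measurable
    also have "\<dots> \<le> (\<integral>\<^sup>+r. ennreal (D * (indicator {0<..} r * (r powr (\<beta> / 2 - 1) * (1 + r) powr (- (real l - \<alpha> / 2))))) *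
        lp_norm p (F (t / 2 + t / 2 * r)) \<partial>lborel)"
    proof (intro nn_integral_mono)
      fix r :: real
      show "ennreal (?T * t) * ?\<phi> (t * r) \<le>
          ennreal (D * (indicator {0<..} r * (r powr (\<beta> / 2 - 1) * (1 + r) powr (- (real l - \<alpha> / 2))))) *
          lp_norm p (F (t / 2 + t / 2 * r))"
      proof (cases "r > 0")
        case r: True
        have s: "(t + t * r) / 2 = t / 2 + t / 2 * r" "t / 2 + t / 2 * r > 0"
          using r t by (simp_all add: field_simps add_pos_pos)
        have v: "v (t / 2 + t / 2 * r) = lp_norm p (F (t / 2 + t / 2 * r))"
          using s(2) by (simp add: v_def)
        have gd: "gamma_density b (t * r) \<le> t powr (b - 1) * r powr (b - 1) / Gamma b"
        proof -
          have "(t * r) powr (b - 1) * exp (- (t * r)) \<le> (t * r) powr (b - 1) * 1"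
            using t r by (intro mult_left_mono) auto
          then show ?thesis
            using t r Gamma_real_pos[OF b] by (simp add: gamma_density_def powr_mult divide_right_mono)
        qed
        have pw: "(t / 2 + t / 2 * r) powr (\<alpha> / 2 - real l) =
            t powr (\<alpha> / 2 - real l) * ((1 + r) powr (\<alpha> / 2 - real l) * 2 powr (real l - \<alpha> / 2))"
        proof -
          have "t / 2 + t / 2 * r = t * ((1 + r) * (1 / 2))" by (simp add: field_simps)
          then have "(t / 2 + t / 2 * r) powr (\<alpha> / 2 - real l) =
              t powr (\<alpha> / 2 - real l) * ((1 + r) powr (\<alpha> / 2 - real l) * (1 / 2) powr (\<alpha> / 2 - real l))"
            using t r by (simp only: powr_mult)
          moreover have "(1 / 2) powr (\<alpha> / 2 - real l) = 2 powr (real l - \<alpha> / 2)"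
            using powr_minus_divide[of 2 "\<alpha> / 2 - real l"] by (simp add: powr_divide)
          ultimately show ?thesis by simp
        qed
        \<comment> \<open>Scaling: the factor \<open>t\<close> is the Jacobian of \<open>\<tau> = t r\<close>, the others come from the norm, the density and the decay.\<close>
        have t1: "?T * t * t powr (b - 1) * t powr (\<alpha> / 2 - real l) = 1"
        proof -
          have "?T * t * t powr (b - 1) * t powr (\<alpha> / 2 - real l) =
              ?T * t powr 1 * t powr (b - 1) * t powr (\<alpha> / 2 - real l)"
            using t by simp
          also have "\<dots> = t powr (real l - (\<alpha> + \<beta>) / 2 + 1 + (b - 1) + (\<alpha> / 2 - real l))"
            by (simp only: powr_add)
          also have "real l - (\<alpha> + \<beta>) / 2 + 1 + (b - 1) + (\<alpha> / 2 - real l) = 0"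
            by (simp add: b_def field_simps)
          finally show ?thesis using t by simp
        qed
        let ?X = "?T * t * (gamma_density b (t * r) * (C * (t / 2 + t / 2 * r) powr (\<alpha> / 2 - real l)))"
        have "?X \<le> ?T * t * ((t powr (b - 1) * r powr (b - 1) / Gamma b) * (C * (t / 2 + t / 2 * r) powr (\<alpha> / 2 - real l)))"
          using t C(1) gd by (intro mult_left_mono mult_right_mono) auto
        also have "\<dots> = (?T * t * t powr (b - 1) * t powr (\<alpha> / 2 - real l)) *
            (D * (r powr (b - 1) * (1 + r) powr (\<alpha> / 2 - real l)))"
          unfolding pw D_def by (simp only: times_divide_eq_left times_divide_eq_right mult_ac)
        also have "\<dots> = D * (indicator {0<..} r * (r powr (\<beta> / 2 - 1) * (1 + r) powr (- (real l - \<alpha> / 2))))"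
          unfolding t1 using r by (simp add: b_def)
        finally have X: "?X \<le> D * (indicator {0<..} r * (r powr (\<beta> / 2 - 1) * (1 + r) powr (- (real l - \<alpha> / 2))))" .
        have "ennreal (?T * t) * ?\<phi> (t * r) = ennreal ?X * lp_norm p (F (t / 2 + t / 2 * r))"
          unfolding s(1) v
          using t C(1) gamma_density_nonneg[OF b] by (intro ennreal_mult_assoc[symmetric]) auto
        also have "\<dots> \<le> ennreal (D * (indicator {0<..} r * (r powr (\<beta> / 2 - 1) * (1 + r) powr (- (real l - \<alpha> / 2))))) *
            lp_norm p (F (t / 2 + t / 2 * r))"
          by (intro mult_right_mono ennreal_leI X) simp
        finally show ?thesis .
      next
        case False
        then have "gamma_density b (t * r) = 0"
          using t by (simp add: gamma_density_def zero_less_mult_iff)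
        then show ?thesis by simp
      qed
    qed
    finally show "lp_norm p (\<lambda>n. ?T * heat_semigroup t ((lap ^^ l) (bessel_potential \<beta> f)) n) \<le>
      (\<integral>\<^sup>+r. ennreal (D * (indicator {0<..} r * (r powr (\<beta> / 2 - 1) * (1 + r) powr (- (real l - \<alpha> / 2))))) *
        lp_norm p (\<lambda>n. (t / 2 + t / 2 * r) powr (real k - \<alpha> / 2) *
          heat_semigroup (t / 2 + t / 2 * r) ((lap ^^ k) f) n) \<partial>lborel)"
      by (simp add: F_def)
  qed
qed

section \<open>Polynomial weights and the growth condition\<close>

definition poly_weight :: "real \<Rightarrow> int \<Rightarrow> real" where
  "poly_weight N n = (1 + \<bar>real_of_int n\<bar>) powr N"

lemma poly_weight_pos: "poly_weight N n > 0"
  by (simp add: poly_weight_def add_pos_nonneg)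

lemma abs_poly_weight [simp]: "\<bar>poly_weight N n\<bar> = poly_weight N n"
  by (rule abs_of_pos[OF poly_weight_pos])

text \<open>
  The bound \<open>ln y \<le> y - 1\<close> at \<open>y = (1 + \<bar>n\<bar>) / K\<close>, where \<open>K\<close> is chosen so that the resulting exponential rate is
  \<open>ln (5 / 4)\<close>.
\<close>

lemma poly_weight_le_geo:
  assumes "N > 0"
  shows "\<exists>C\<ge>0. \<forall>n. poly_weight N n \<le> C * geo_weight n"
proof -
  define a where "a = ln (5 / 4 :: real)"
  have a: "a > 0" by (simp add: a_def)
  define K where "K = N / a"
  have K: "K > 0" using a assms by (simp add: K_def)
  have "poly_weight N n \<le> exp (N * ln K + a - N) * geo_weight n" for n
  proof -
    define x where "x = \<bar>real_of_int n\<bar>"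
    have x: "x \<ge> 0" by (simp add: x_def)
    have "ln (1 + x) = ln K + ln ((1 + x) / K)"
      using K x by (simp add: ln_div)
    also have "\<dots> \<le> ln K + ((1 + x) / K - 1)"
      using K x by (intro add_left_mono ln_le_minus_one) (simp add: add_pos_nonneg)
    finally have "N * ln (1 + x) \<le> N * (ln K + ((1 + x) / K - 1))"
      using assms by (intro mult_left_mono) auto
    also have "\<dots> = N * ln K + a - N + a * x"
      using assms a by (simp add: K_def field_simps)
    finally have "exp (N * ln (1 + x)) \<le> exp (N * ln K + a - N) * exp (a * x)"
      by (simp add: exp_add[symmetric])
    moreover have "exp (a * x) = geo_weight n"
    proof -
      have "x = real (nat \<bar>n\<bar>)" by (simp add: x_def)
      then have "exp (a * x) = exp a ^ nat \<bar>n\<bar>"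
        by (simp only: exp_of_nat2_mult)
      then show ?thesis
        by (simp add: geo_weight_def a_def)
    qed
    ultimately show ?thesis
      using x by (simp add: poly_weight_def x_def powr_def)
  qed
  then show ?thesis by (intro exI[of _ "exp (N * ln K + a - N)"]) auto
qed

text \<open>
  Peetre's inequality, from \<open>1 + \<bar>n - m\<bar> \<le> (1 + \<bar>n\<bar>) (1 + \<bar>m\<bar>)\<close>.
\<close>

lemma poly_weight_moderate:
  assumes "N > 0"
  shows "poly_weight (- N) n \<le> poly_weight N m * poly_weight (- N) (n - m)"
proof -
  let ?x = "\<bar>real_of_int n\<bar>" and ?y = "\<bar>real_of_int m\<bar>" and ?z = "\<bar>real_of_int (n - m)\<bar>"
  have "?z \<le> ?x + ?y" by simp
  also have "1 + (?x + ?y) \<le> (1 + ?x) * (1 + ?y)" by (simp add: algebra_simps)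
  finally have "1 + ?z \<le> (1 + ?x) * (1 + ?y)" by simp
  then have "((1 + ?x) * (1 + ?y)) powr (- N) \<le> (1 + ?z) powr (- N)"
    using assms by (intro powr_mono2') auto
  then have "(1 + ?x) powr (- N) * (1 + ?y) powr (- N) \<le> (1 + ?z) powr (- N)"
    by (simp add: powr_mult)
  then have "(1 + ?y) powr N * ((1 + ?x) powr (- N) * (1 + ?y) powr (- N)) \<le> (1 + ?y) powr N * (1 + ?z) powr (- N)"
    by (intro mult_left_mono) auto
  moreover have "(1 + ?y) powr N * (1 + ?y) powr (- N) = 1"
    by (simp add: powr_add[symmetric] add_pos_nonneg)
  ultimately show ?thesis
    unfolding poly_weight_def by (simp only: mult.left_commute[of "(1 + ?y) powr N"] mult_1_right)
qed

text \<open>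
  Young's inequality with a polynomial weight: translating by \<open>m\<close> changes the weighted norm by at most
  \<open>poly_weight N m\<close>, which the exponential weight in \<open>geo_norm\<close> dominates.
\<close>

lemma lp_norm_weighted_conv_le:
  assumes q: "q \<ge> 1" and N: "N > 0" and C: "C \<ge> 0" "\<And>n. poly_weight N n \<le> C * geo_weight n"
  shows "lp_norm q (\<lambda>n. poly_weight (- N) n * conv a f n) \<le>
    ennreal C * geo_norm a * lp_norm q (\<lambda>n. poly_weight (- N) n * f n)"
proof -
  let ?\<rho> = "poly_weight (- N)"
  have "lp_norm q (\<lambda>n. ?\<rho> n * conv a f n) \<le> (\<integral>\<^sup>+m. lp_norm q (\<lambda>n. ?\<rho> n * (a m * f (n - m))) \<partial>counting)"
  proof (rule lp_norm_le_nn_integral[OF q])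
    fix n
    have "ennreal \<bar>?\<rho> n * conv a f n\<bar> = ennreal (?\<rho> n) * ennreal \<bar>conv a f n\<bar>"
      using poly_weight_pos[of "- N" n] by (simp add: abs_mult ennreal_mult)
    also have "\<dots> \<le> ennreal (?\<rho> n) * (\<integral>\<^sup>+j. ennreal \<bar>a (n - j) * f j\<bar> \<partial>counting)"
      by (intro mult_left_mono abs_conv_le_nn_integral) simp
    also have "\<dots> = ennreal (?\<rho> n) * (\<integral>\<^sup>+m. ennreal \<bar>a m * f (n - m)\<bar> \<partial>counting)"
      using nn_integral_reflect[of "\<lambda>j. ennreal \<bar>a (n - j) * f j\<bar>" n] by simp
    also have "\<dots> = (\<integral>\<^sup>+m. ennreal (?\<rho> n) * ennreal \<bar>a m * f (n - m)\<bar> \<partial>counting)"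
      by (rule nn_integral_cmult[symmetric]) simp
    also have "\<dots> = (\<integral>\<^sup>+m. ennreal \<bar>?\<rho> n * (a m * f (n - m))\<bar> \<partial>counting)"
      using poly_weight_pos[of "- N" n] by (simp add: abs_mult[of "?\<rho> n"] ennreal_mult)
    finally show "ennreal \<bar>?\<rho> n * conv a f n\<bar> \<le> (\<integral>\<^sup>+m. ennreal \<bar>?\<rho> n * (a m * f (n - m))\<bar> \<partial>counting)" .
  qed simp
  also have "\<dots> \<le> (\<integral>\<^sup>+m. ennreal C * ennreal (geo_weight m * \<bar>a m\<bar>) * lp_norm q (\<lambda>n. ?\<rho> n * f n) \<partial>counting)"
  proof (intro nn_integral_mono)
    fix m
    have "\<bar>?\<rho> n * (a m * f (n - m))\<bar> \<le> \<bar>(C * (geo_weight m * \<bar>a m\<bar>)) * (?\<rho> (n - m) * f (n - m))\<bar>" for n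
    proof -
      have "?\<rho> n \<le> C * geo_weight m * ?\<rho> (n - m)"
        using order_trans[OF poly_weight_moderate[OF N] mult_right_mono[OF C(2)]] poly_weight_pos[of "- N" "n - m"]
        by (simp add: less_imp_le)
      then have "?\<rho> n * (\<bar>a m\<bar> * \<bar>f (n - m)\<bar>) \<le> C * geo_weight m * ?\<rho> (n - m) * (\<bar>a m\<bar> * \<bar>f (n - m)\<bar>)"
        by (intro mult_right_mono) auto
      then show ?thesis
        using C(1) poly_weight_pos[of "- N"] geo_weight_pos[of m] by (simp add: abs_mult mult_ac)
    qed
    then have "lp_norm q (\<lambda>n. ?\<rho> n * (a m * f (n - m))) \<le>
        lp_norm q (\<lambda>n. (C * (geo_weight m * \<bar>a m\<bar>)) * (?\<rho> (n - m) * f (n - m)))"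
      by (rule lp_norm_mono[OF _ q])
    also have "\<dots> = ennreal (C * (geo_weight m * \<bar>a m\<bar>)) * lp_norm q (\<lambda>n. ?\<rho> (n - m) * f (n - m))"
      using C(1) geo_weight_pos[of m] by (subst lp_norm_cmult[OF q]) simp
    also have "lp_norm q (\<lambda>n. ?\<rho> (n - m) * f (n - m)) = lp_norm q (\<lambda>n. ?\<rho> n * f n)"
    proof -
      have "bij (\<lambda>n::int. n - m)"
        by (rule bij_betw_byWitness[where f'="\<lambda>n. n + m"]) auto
      then show ?thesis by (rule lp_norm_reindex[of _ _ "\<lambda>n. ?\<rho> n * f n"])
    qed
    also have "ennreal (C * (geo_weight m * \<bar>a m\<bar>)) = ennreal C * ennreal (geo_weight m * \<bar>a m\<bar>)"
      using C(1) geo_weight_pos[of m] by (simp add: ennreal_mult)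
    finally show "lp_norm q (\<lambda>n. ?\<rho> n * (a m * f (n - m))) \<le>
        ennreal C * ennreal (geo_weight m * \<bar>a m\<bar>) * lp_norm q (\<lambda>n. ?\<rho> n * f n)" .
  qed
  also have "\<dots> = ennreal C * geo_norm a * lp_norm q (\<lambda>n. ?\<rho> n * f n)"
    by (simp add: nn_integral_multc nn_integral_cmult geo_norm_def)
  finally show ?thesis .
qed

lemma lp_norm_weighted_bessel_finite:
  assumes q: "q \<ge> 1" and N: "N > 0" and \<beta>: "\<beta> > 0" and f: "exp_growth f"
    and fin: "lp_norm q (\<lambda>n. poly_weight (- N) n * f n) < \<infinity>"
  shows "lp_norm q (\<lambda>n. poly_weight (- N) n * bessel_potential \<beta> f n) < \<infinity>"
proof -
  let ?\<rho> = "poly_weight (- N)" and ?g = "gamma_density (\<beta> / 2)"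
  obtain C where C: "C \<ge> 0" "\<And>n. poly_weight N n \<le> C * geo_weight n"
    using poly_weight_le_geo[OF N] by blast
  have b: "\<beta> / 2 > 0" using \<beta> by simp
  let ?L = "lp_norm q (\<lambda>n. ?\<rho> n * f n)"
  have "lp_norm q (\<lambda>n. ?\<rho> n * bessel_potential \<beta> f n) \<le>
      (\<integral>\<^sup>+\<tau>. lp_norm q (\<lambda>n. ?\<rho> n * (?g \<tau> * heat_semigroup \<tau> f n)) \<partial>lborel)"
  proof (rule lp_norm_le_nn_integral[OF q])
    fix n
    note [measurable] = measurable_gamma_heat[OF f, of "\<beta> / 2" n]
    show "(\<lambda>\<tau>. ?\<rho> n * (?g \<tau> * heat_semigroup \<tau> f n)) \<in> borel_measurable lborel"
      by measurable
    have "ennreal \<bar>?\<rho> n * bessel_potential \<beta> f n\<bar> = ennreal (?\<rho> n) * ennreal \<bar>bessel_potential \<beta> f n\<bar>"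
      using poly_weight_pos[of "- N" n] by (simp add: abs_mult ennreal_mult)
    also have "\<dots> \<le> ennreal (?\<rho> n) * (\<integral>\<^sup>+\<tau>. ennreal \<bar>?g \<tau> * heat_semigroup \<tau> f n\<bar> \<partial>lborel)"
      by (intro mult_left_mono abs_bessel_le_nn_integral \<beta>) simp
    also have "\<dots> = (\<integral>\<^sup>+\<tau>. ennreal (?\<rho> n) * ennreal \<bar>?g \<tau> * heat_semigroup \<tau> f n\<bar> \<partial>lborel)"
      by (rule nn_integral_cmult[symmetric]) measurable
    also have "\<dots> = (\<integral>\<^sup>+\<tau>. ennreal \<bar>?\<rho> n * (?g \<tau> * heat_semigroup \<tau> f n)\<bar> \<partial>lborel)"
      using poly_weight_pos[of "- N" n] by (simp add: abs_mult[of "?\<rho> n"] ennreal_mult)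
    finally show "ennreal \<bar>?\<rho> n * bessel_potential \<beta> f n\<bar> \<le>
        (\<integral>\<^sup>+\<tau>. ennreal \<bar>?\<rho> n * (?g \<tau> * heat_semigroup \<tau> f n)\<bar> \<partial>lborel)" .
  qed
  also have "\<dots> \<le> (\<integral>\<^sup>+\<tau>. ennreal (?g \<tau> * exp (\<tau> / 2)) * (ennreal C * ?L) \<partial>lborel)"
  proof (intro nn_integral_mono)
    fix \<tau> :: real
    have eq: "lp_norm q (\<lambda>n. ?\<rho> n * (?g \<tau> * heat_semigroup \<tau> f n)) =
        ennreal (?g \<tau>) * lp_norm q (\<lambda>n. ?\<rho> n * heat_semigroup \<tau> f n)"
      using lp_norm_cmult[OF q, of "?g \<tau>" "\<lambda>n. ?\<rho> n * heat_semigroup \<tau> f n"] gamma_density_nonneg[OF b, of \<tau>]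
      by (simp add: mult_ac)
    show "lp_norm q (\<lambda>n. ?\<rho> n * (?g \<tau> * heat_semigroup \<tau> f n)) \<le> ennreal (?g \<tau> * exp (\<tau> / 2)) * (ennreal C * ?L)"
    proof (cases "\<tau> > 0")
      case True
      have "lp_norm q (\<lambda>n. ?\<rho> n * heat_semigroup \<tau> f n) \<le> ennreal C * geo_norm (heat_kernel \<tau>) * ?L"
        unfolding heat_semigroup_eq_conv by (rule lp_norm_weighted_conv_le[OF q N C])
      also have "\<dots> \<le> ennreal C * ennreal (exp (\<tau> / 2)) * ?L"
        by (intro mult_left_mono mult_right_mono geo_norm_heat_kernel_le True) auto
      finally have "ennreal (?g \<tau>) * lp_norm q (\<lambda>n. ?\<rho> n * heat_semigroup \<tau> f n) \<le>
          ennreal (?g \<tau>) * (ennreal C * ennreal (exp (\<tau> / 2)) * ?L)"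
        by (rule mult_left_mono) simp
      also have "\<dots> = ennreal (?g \<tau>) * ennreal (exp (\<tau> / 2)) * (ennreal C * ?L)"
        by (simp only: mult_ac)
      also have "ennreal (?g \<tau>) * ennreal (exp (\<tau> / 2)) = ennreal (?g \<tau> * exp (\<tau> / 2))"
        using gamma_density_nonneg[OF b, of \<tau>] by (simp add: ennreal_mult)
      finally show ?thesis unfolding eq .
    next
      case False
      then have "?g \<tau> = 0" by (simp add: gamma_density_def)
      then show ?thesis unfolding eq by simp
    qed
  qed
  also have "\<dots> = (\<integral>\<^sup>+\<tau>. ennreal (?g \<tau> * exp (\<tau> / 2)) \<partial>lborel) * (ennreal C * ?L)"
    by (rule nn_integral_multc) measurable
  also have "\<dots> < \<infinity>"
    using nn_integral_gamma_density_finite[OF b] fin by (simp add: ennreal_mult_less_top)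
  finally show ?thesis .
qed

text \<open>
  The measure weight \<open>1 / (1 + \<bar>n\<bar>)\<close> becomes a factor of the sequence, with its \<open>q\<close>-th root. For \<open>q = \<infinity>\<close> the conventions
  \<open>enn2real \<infinity> = 0\<close> and \<open>1 / 0 = 0\<close> give the weight \<open>1\<close>, as they should.
\<close>

lemma weighted_lq_iff:
  assumes q: "q \<ge> 1"
  shows "g \<in> weighted_lq q \<longleftrightarrow> lp_norm q (\<lambda>n. poly_weight (- (1 / enn2real q)) n * g n) < \<infinity>"
proof (cases "q = \<infinity>")
  case True
  have one: "poly_weight (- (1 / enn2real q)) n = 1" for n
    using True by (simp add: poly_weight_def add_pos_nonneg add_nonneg_eq_0_iff)
  have "bounded (range g) \<longleftrightarrow> (SUP n. ennreal \<bar>g n\<bar>) < \<infinity>"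
  proof
    assume "bounded (range g)"
    then obtain B where "\<And>n. \<bar>g n\<bar> \<le> B" by (auto simp: bounded_iff)
    then have "(SUP n. ennreal \<bar>g n\<bar>) \<le> ennreal B" by (intro SUP_least ennreal_leI) auto
    then show "(SUP n. ennreal \<bar>g n\<bar>) < \<infinity>" by (auto intro: le_less_trans)
  next
    assume "(SUP n. ennreal \<bar>g n\<bar>) < \<infinity>"
    then obtain B where B: "B \<ge> 0" "(SUP n. ennreal \<bar>g n\<bar>) = ennreal B"
      by (cases "SUP n. ennreal \<bar>g n\<bar>") auto
    have "\<bar>g n\<bar> \<le> B" for n
      using SUP_upper[of n UNIV "\<lambda>n. ennreal \<bar>g n\<bar>"] B by simp
    then show "bounded (range g)" by (auto simp: bounded_iff)
  qed
  then show ?thesis unfolding one using True by (simp add: weighted_lq_def lp_norm_def)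
next
  case False
  let ?r = "enn2real q"
  have r: "?r \<ge> 1" using enn2real_ge_1[OF False q] .
  have eq: "\<bar>poly_weight (- (1 / ?r)) n * g n\<bar> powr ?r = \<bar>g n\<bar> powr ?r * (1 / (1 + \<bar>real_of_int n\<bar>))" for n
  proof -
    have "\<bar>poly_weight (- (1 / ?r)) n * g n\<bar> powr ?r = poly_weight (- (1 / ?r)) n powr ?r * \<bar>g n\<bar> powr ?r"
      using poly_weight_pos[of "- (1 / ?r)" n] by (simp add: abs_mult powr_mult)
    also have "poly_weight (- (1 / ?r)) n powr ?r = 1 / (1 + \<bar>real_of_int n\<bar>)"
    proof -
      have "poly_weight (- (1 / ?r)) n powr ?r = (1 + \<bar>real_of_int n\<bar>) powr (- 1)"
        unfolding poly_weight_def powr_powr using r by simp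
      also have "\<dots> = 1 / (1 + \<bar>real_of_int n\<bar>)"
        by (subst powr_minus_divide) simp
      finally show ?thesis .
    qed
    finally show ?thesis by simp
  qed
  let ?u = "\<lambda>n. \<bar>g n\<bar> powr ?r * (1 / (1 + \<bar>real_of_int n\<bar>))"
  have "?u summable_on UNIV \<longleftrightarrow> Infinite_Sum.abs_summable_on ?u UNIV"
    by (rule summable_on_iff_abs_summable_on_real)
  also have "\<dots> \<longleftrightarrow> integrable counting ?u"
    unfolding abs_summable_equivalent abs_summable_on_def ..
  also have "\<dots> \<longleftrightarrow> (\<integral>\<^sup>+n. ennreal (?u n) \<partial>counting) < \<infinity>"
    by (simp add: integrable_iff_bounded)
  finally show ?thesis
    using False unfolding weighted_lq_def lp_norm_def eq
    by (simp add: ennpowr_less_top_iff[simplified])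
qed

text \<open>
  The weights \<open>1 + \<bar>n\<bar> powr \<alpha>\<close> and \<open>(1 + \<bar>n\<bar>) powr \<alpha>\<close> are comparable. The latter is moderate with constant one
  and combines with the measure weight into a single power, uniformly in \<open>q\<close>.
\<close>

lemma growth_weighted_iff:
  assumes q: "q \<ge> 1" and \<alpha>: "\<alpha> > 0"
  shows "(\<lambda>n. f n / (1 + \<bar>real_of_int n\<bar> powr \<alpha>)) \<in> weighted_lq q \<longleftrightarrow>
    lp_norm q (\<lambda>n. poly_weight (- (\<alpha> + 1 / enn2real q)) n * f n) < \<infinity>"
proof -
  let ?e = "1 / enn2real q"
  let ?A = "\<lambda>n. poly_weight (- ?e) n * (f n / (1 + \<bar>real_of_int n\<bar> powr \<alpha>))"
  let ?B = "\<lambda>n. poly_weight (- (\<alpha> + ?e)) n * f n"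
  have split: "poly_weight (- (\<alpha> + ?e)) n = poly_weight (- ?e) n * (1 / (1 + \<bar>real_of_int n\<bar>) powr \<alpha>)" for n
    by (simp add: poly_weight_def powr_minus_divide[symmetric] powr_add[symmetric] algebra_simps)
  have up: "1 / (1 + x) powr \<alpha> \<le> 2 * (1 / (1 + x powr \<alpha>))" if "x \<ge> 0" for x :: real
  proof -
    have "x powr \<alpha> \<le> (1 + x) powr \<alpha>" "1 \<le> (1 + x) powr \<alpha>"
      using that \<alpha> by (auto intro!: powr_mono2 ge_one_powr_ge_zero)
    then have "1 + x powr \<alpha> \<le> 2 * (1 + x) powr \<alpha>" by linarith
    then show ?thesis using that by (simp add: field_simps add_pos_nonneg)
  qed
  have lo: "1 / (1 + x powr \<alpha>) \<le> 2 powr \<alpha> * (1 / (1 + x) powr \<alpha>)" if "x \<ge> 0" for x :: real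
  proof -
    have "(1 + x) powr \<alpha> \<le> (2 * max 1 x) powr \<alpha>"
      using that \<alpha> by (intro powr_mono2) auto
    also have "\<dots> = 2 powr \<alpha> * (max 1 x) powr \<alpha>"
      by (simp add: powr_mult)
    also have "\<dots> \<le> 2 powr \<alpha> * (1 + x powr \<alpha>)"
      by (intro mult_left_mono) (auto simp: max_def)
    finally show ?thesis using that by (simp add: field_simps add_pos_nonneg)
  qed
  have A: "\<bar>?B n\<bar> \<le> \<bar>2 * ?A n\<bar>" for n
  proof -
    have "poly_weight (- ?e) n * \<bar>f n\<bar> * (1 / (1 + \<bar>real_of_int n\<bar>) powr \<alpha>) \<le>
        poly_weight (- ?e) n * \<bar>f n\<bar> * (2 * (1 / (1 + \<bar>real_of_int n\<bar> powr \<alpha>)))"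
      by (intro mult_left_mono up) (auto simp: less_imp_le[OF poly_weight_pos])
    then show ?thesis
      unfolding split using poly_weight_pos[of "- ?e" n] by (simp add: abs_mult add_pos_nonneg mult_ac)
  qed
  have B: "\<bar>?A n\<bar> \<le> \<bar>2 powr \<alpha> * ?B n\<bar>" for n
  proof -
    have "poly_weight (- ?e) n * \<bar>f n\<bar> * (1 / (1 + \<bar>real_of_int n\<bar> powr \<alpha>)) \<le>
        poly_weight (- ?e) n * \<bar>f n\<bar> * (2 powr \<alpha> * (1 / (1 + \<bar>real_of_int n\<bar>) powr \<alpha>))"
      by (intro mult_left_mono lo) (auto simp: less_imp_le[OF poly_weight_pos])
    then show ?thesis
      unfolding split using poly_weight_pos[of "- ?e" n] by (simp add: abs_mult add_pos_nonneg mult_ac)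
  qed
  have "lp_norm q ?B \<le> ennreal 2 * lp_norm q ?A" "lp_norm q ?A \<le> ennreal (2 powr \<alpha>) * lp_norm q ?B"
    using lp_norm_mono[OF A q] lp_norm_mono[OF B q] unfolding lp_norm_cmult[OF q] by simp_all
  then have "lp_norm q ?A < \<infinity> \<longleftrightarrow> lp_norm q ?B < \<infinity>"
    by (auto simp: ennreal_mult_less_top intro: le_less_trans)
  then show ?thesis unfolding weighted_lq_iff[OF q] .
qed

lemma exp_growth_of_weighted:
  assumes q: "q \<ge> 1" and N: "N > 0" and fin: "lp_norm q (\<lambda>n. poly_weight (- N) n * f n) < \<infinity>"
  shows "exp_growth f"
proof -
  obtain M where M: "M \<ge> 0" "lp_norm q (\<lambda>n. poly_weight (- N) n * f n) = ennreal M"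
    using fin by (cases "lp_norm q (\<lambda>n. poly_weight (- N) n * f n)") auto
  obtain C where C: "C \<ge> 0" "\<And>n. poly_weight N n \<le> C * geo_weight n"
    using poly_weight_le_geo[OF N] by blast
  have "\<bar>f n\<bar> \<le> (M * C) * geo_weight n" for n
  proof -
    have "\<bar>poly_weight (- N) n * f n\<bar> \<le> M"
      using abs_le_lp_norm[OF q, of "\<lambda>n. poly_weight (- N) n * f n" n] M by simp
    then have "poly_weight N n * \<bar>poly_weight (- N) n * f n\<bar> \<le> poly_weight N n * M"
      using poly_weight_pos[of N n] by (intro mult_left_mono) auto
    moreover have "poly_weight N n * \<bar>poly_weight (- N) n * f n\<bar> = \<bar>f n\<bar>"
    proof -
      have "poly_weight N n * poly_weight (- N) n = 1"
        by (simp add: poly_weight_def powr_add[symmetric] add_pos_nonneg)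
      then show ?thesis
        using poly_weight_pos[of "- N" n] by (simp add: abs_mult mult.assoc[symmetric])
    qed
    moreover have "poly_weight N n * M \<le> C * geo_weight n * M"
      by (intro mult_right_mono C M)
    ultimately show ?thesis by (simp add: mult_ac)
  qed
  then show ?thesis by (rule exp_growthI)
qed

section \<open>Bessel potentials raise the order of smoothness\<close>

theorem theorem1p2:
  fixes \<alpha> \<beta> :: real and p q :: ennreal and f :: "int \<Rightarrow> real"
  assumes "\<alpha> > 0" and "\<beta> > 0" and "1 \<le> p" and "1 \<le> q"
    and "f \<in> Lambda_H \<alpha> p q"
  shows "bessel_potential \<beta> f \<in> Lambda_H (\<alpha> + \<beta>) p q"
proof -
  let ?e = "1 / enn2real q" and ?g = "bessel_potential \<beta> f"
  define k where "k = nat \<lfloor>\<alpha> / 2\<rfloor> + 1"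
  define l where "l = nat \<lfloor>(\<alpha> + \<beta>) / 2\<rfloor> + 1"
  have N: "\<alpha> + ?e > 0" using assms(1) by (simp add: add_pos_nonneg)
  have fin: "lp_norm q (\<lambda>n. poly_weight (- (\<alpha> + ?e)) n * f n) < \<infinity>"
    using assms(5) growth_weighted_iff[OF assms(4,1)] by (simp add: Lambda_H_def)
  have f: "exp_growth f"
    by (rule exp_growth_of_weighted[OF assms(4) N fin])
  have g: "exp_growth ?g"
    by (rule exp_growth_bessel[OF assms(2) f])
  have "lp_norm q (\<lambda>n. poly_weight (- (\<alpha> + \<beta> + ?e)) n * ?g n) \<le> lp_norm q (\<lambda>n. poly_weight (- (\<alpha> + ?e)) n * ?g n)"
  proof (rule lp_norm_mono[OF _ assms(4)])
    fix n
    have "poly_weight (- (\<alpha> + \<beta> + ?e)) n \<le> poly_weight (- (\<alpha> + ?e)) n"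
      unfolding poly_weight_def using assms(2) by (intro powr_mono) auto
    then show "\<bar>poly_weight (- (\<alpha> + \<beta> + ?e)) n * ?g n\<bar> \<le> \<bar>poly_weight (- (\<alpha> + ?e)) n * ?g n\<bar>"
      using poly_weight_pos[of _ n] by (simp add: abs_mult mult_right_mono)
  qed
  also have "\<dots> < \<infinity>"
    by (rule lp_norm_weighted_bessel_finite[OF assms(4) N assms(2) f fin])
  finally have growth: "(\<lambda>n. ?g n / (1 + \<bar>real_of_int n\<bar> powr (\<alpha> + \<beta>))) \<in> weighted_lq q"
    using growth_weighted_iff[OF assms(4), of "\<alpha> + \<beta>" ?g] assms(1,2) by simp
  let ?F = "\<lambda>t n. t powr (real k - \<alpha> / 2) * (deriv ^^ k) (\<lambda>s. heat_semigroup s f n) t"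
  let ?G = "\<lambda>t n. t powr (real l - (\<alpha> + \<beta>) / 2) * (deriv ^^ l) (\<lambda>s. heat_semigroup s ?g n) t"
  have F: "?F t = (\<lambda>n. t powr (real k - \<alpha> / 2) * heat_semigroup t ((lap ^^ k) f) n)" if "t > 0" for t
    using higher_deriv_heat[OF f that] by simp
  have G: "?G t = (\<lambda>n. t powr (real l - (\<alpha> + \<beta>) / 2) * heat_semigroup t ((lap ^^ l) ?g) n)" if "t > 0" for t
    using higher_deriv_heat[OF g that] by simp
  have meas: "(\<lambda>t. indicator {0<..} t * (t powr a * (deriv ^^ j) (\<lambda>s. heat_semigroup s h n) t)) \<in> borel_measurable borel"
    if h: "exp_growth h" for a j h n
  proof -
    note [measurable] = measurable_indicator_heat[OF exp_growth_lap_power[OF h, of j], of n]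
    have "(\<lambda>t. t powr a * (indicator {0<..} t * heat_semigroup t ((lap ^^ j) h) n)) \<in> borel_measurable borel"
      by measurable
    also have "(\<lambda>t. t powr a * (indicator {0<..} t * heat_semigroup t ((lap ^^ j) h) n)) =
        (\<lambda>t. indicator {0<..} t * (t powr a * (deriv ^^ j) (\<lambda>s. heat_semigroup s h n) t))"
      using higher_deriv_heat[OF h] by (auto simp: fun_eq_iff indicator_def)
    finally show ?thesis .
  qed
  have kl: "k \<le> l"
    unfolding k_def l_def using assms(2) by (intro add_right_mono nat_mono floor_mono) auto
  have l: "real l > (\<alpha> + \<beta>) / 2"
    unfolding l_def using assms(1,2) by linarith
  obtain D where D: "D \<ge> 0" "\<And>t. t > 0 \<Longrightarrow>
      lp_norm p (\<lambda>n. t powr (real l - (\<alpha> + \<beta>) / 2) * heat_semigroup t ((lap ^^ l) ?g) n) \<le>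
      (\<integral>\<^sup>+r. ennreal (D * (indicator {0<..} r * (r powr (\<beta> / 2 - 1) * (1 + r) powr (- (real l - \<alpha> / 2))))) *
        lp_norm p (\<lambda>n. (t / 2 + t / 2 * r) powr (real k - \<alpha> / 2) *
          heat_semigroup (t / 2 + t / 2 * r) ((lap ^^ k) f) n) \<partial>lborel)"
    by (rule heat_bessel_average[OF assms(3,2) f kl, where \<alpha>=\<alpha>]) (rule that)
  let ?w = "\<lambda>r. ennreal (D * (indicator {0<..} r * (r powr (\<beta> / 2 - 1) * (1 + r) powr (- (real l - \<alpha> / 2)))))"
  have "mixed_norm p q ?G < \<infinity>"
  proof (rule mixed_norm_average_finite[where F="?F" and w="?w"])
    show "?w \<in> borel_measurable borel" by measurable
    have "(\<integral>\<^sup>+r. ?w r \<partial>lborel) =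
        (\<integral>\<^sup>+r. ennreal D * ennreal (indicator {0<..} r * (r powr (\<beta> / 2 - 1) * (1 + r) powr (- (real l - \<alpha> / 2)))) \<partial>lborel)"
      using D(1) by (intro nn_integral_cong) (simp add: ennreal_mult')
    also have "\<dots> = ennreal D *
        (\<integral>\<^sup>+r. ennreal (indicator {0<..} r * (r powr (\<beta> / 2 - 1) * (1 + r) powr (- (real l - \<alpha> / 2)))) \<partial>lborel)"
      by (rule nn_integral_cmult) measurable
    also have "\<dots> < \<infinity>"
      using nn_integral_beta_weight_finite[of "\<beta> / 2" "real l - \<alpha> / 2"] assms(2) l
      by (simp add: ennreal_mult_less_top field_simps)
    finally show "(\<integral>\<^sup>+r. ?w r \<partial>lborel) < \<infinity>" .
    fix t :: real assume t: "t > 0"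
    have "?w r * lp_norm p (?F (t / 2 + t / 2 * r)) = ?w r * lp_norm p (\<lambda>n. (t / 2 + t / 2 * r) powr (real k - \<alpha> / 2) *
          heat_semigroup (t / 2 + t / 2 * r) ((lap ^^ k) f) n)" for r
    proof (cases "r > 0")
      case True
      then have "t / 2 + t / 2 * r > 0" using t by (simp add: add_pos_pos)
      then show ?thesis by (simp only: F)
    qed simp
    then show "lp_norm p (?G t) \<le> (\<integral>\<^sup>+r. ?w r * lp_norm p (?F (t / 2 + t / 2 * r)) \<partial>lborel)"
      using D(2)[OF t] unfolding G[OF t] by simp
  next
    show "mixed_norm p q ?F < \<infinity>"
      using assms(5) by (simp add: Lambda_H_def k_def Let_def)
  qed (use assms(3,4) meas[OF f] meas[OF g] in auto)
  then show ?thesis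
    using growth by (simp add: Lambda_H_def l_def Let_def)
qed

end
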